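(* Let $\mathbf{C}$ be a nontrivial monoidal $\dagger$-category with simple tensor unit $I$ and with all finite $\dagger$-limits. Then the involutive semiring of scalars $\mathrm{Hom}(I,I)$ has an involution-preserving (semiring) embedding into an involutive field which has characteristic $0$ and whose fixed field is orderable.
   Context: Composition is written in diagrammatic order: $f;g$ means first $f$, then $g$. A $\dagger$-category is a category with a contravariant endofunctor $\dagger$ that is the identity on objects and satisfies $(f^\dagger)^\dagger=f$. For the present purposes a monoidal $\dagger$-category is a monoidal category (with unit object $I$) that is also a $\dagger$-category; no compatibility between the tensor and $\dagger$ is assumed. $\dagger$-limits: suppose $\mathbf{C}$ is enriched in commutative monoids, i.e. each hom-set is a commutative monoid $(+,0_{A,B})$ and composition is bilinear. A finite forest-shaped multigraph is a finite directed multigraph (possibly empty) each of whose connected components is a finite tree oriented from its leaves towards a single root, where several parallel arrows between adjacent nodes are allowed; the leaves are the objects that are not the target of any (non-identity) arrow. A finite diagram is a functor $F:\mathbf{J}\to\mathbf{C}$ with $\mathbf{J}$ the free category on such a multigraph. A $\dagger$-limit of $F$ is an ordinary limit $(L,\,l_S:L\to F(S))$ of $F$ satisfying $\sum_{S \text{ leaf of } \mathbf{J}} l_S;l_S^\dagger=\mathrm{id}_L$. $\mathbf{C}$ has all finite $\dagger$-limits if every finite diagram has a $\dagger$-limit (in which case the enrichment is unique, and $\mathbf{C}$ has a zero object whose zero morphisms are the $0_{A,B}$). The scalars are the elements of $\mathrm{Hom}(I,I)$; they form a commutative semiring with addition the hom-set addition, multiplication composition, and involution $a\mapsto a^\dagger$.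 The tensor unit is simple if every monomorphism into $I$ is either zero or an isomorphism. Nontrivial means that $0\neq 1$ in the scalars, i.e. $0_{I,I}\neq \mathrm{id}_I$. An involutive semiring (field) is one equipped with an automorphism squaring to the identity; the fixed field is the subfield on which the involution acts trivially. A semiring has characteristic $0$ if no finite sum $1+1+\cdots+1$ is $0$. A field is orderable if it admits a total order $\le$ such that $a\le b\Rightarrow a+c\le b+c$, and $0\le a,\,0\le b\Rightarrow 0\le ab$. *)

theory Defs
  imports
    "HOL-Algebra.QuotRing"
    "Graph_Theory.Digraph_Component"
    "Graph_Theory.Vertex_Walk"
    "Graph_Theory.Arc_Walk"
begin

section \<open>Categories\<close>

text \<open>Composition \<open>f \<Zsemi> g\<close> is written in diagrammatic order: first \<open>f\<close>, then \<open>g\<close>.\<close>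

record ('o, 'm) category =
  objs :: "'o set"
  arrs :: "'m set"
  src :: "'m \<Rightarrow> 'o"
  trg :: "'m \<Rightarrow> 'o"
  idn :: "'o \<Rightarrow> 'm"
  seqc :: "'m \<Rightarrow> 'm \<Rightarrow> 'm"  (infixl \<open>\<Zsemi>\<index>\<close> 70)

definition homset :: "('o, 'm, 'z) category_scheme \<Rightarrow> 'o \<Rightarrow> 'o \<Rightarrow> 'm set" where
  "homset C A B = {f \<in> arrs C. src C f = A \<and> trg C f = B}"

locale category =
  fixes C :: "('o, 'm, 'z) category_scheme" (structure)
  assumes src_in_objs: "f \<in> arrs C \<Longrightarrow> src C f \<in> objs C"
    and trg_in_objs: "f \<in> arrs C \<Longrightarrow> trg C f \<in> objs C"
    and idn_in_homset: "A \<in> objs C \<Longrightarrow> idn C A \<in> homset C A A"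
    and seqc_in_homset: "\<lbrakk>f \<in> homset C X Y; g \<in> homset C Y Z\<rbrakk> \<Longrightarrow> f \<Zsemi> g \<in> homset C X Z"
    and idn_seqc: "f \<in> homset C X Y \<Longrightarrow> idn C X \<Zsemi> f = f"
    and seqc_idn: "f \<in> homset C X Y \<Longrightarrow> f \<Zsemi> idn C Y = f"
    and seqc_assoc: "\<lbrakk>f \<in> homset C X Y; g \<in> homset C Y Z; h \<in> homset C Z W\<rbrakk>
      \<Longrightarrow> (f \<Zsemi> g) \<Zsemi> h = f \<Zsemi> (g \<Zsemi> h)"

definition monic :: "('o, 'm, 'z) category_scheme \<Rightarrow> 'm \<Rightarrow> bool" where
  "monic C m \<longleftrightarrow> m \<in> arrs C \<and>
    (\<forall>X\<in>objs C. \<forall>f\<in>homset C X (src C m). \<forall>g\<in>homset C X (src C m).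
      f \<Zsemi>\<^bsub>C\<^esub> m = g \<Zsemi>\<^bsub>C\<^esub> m \<longrightarrow> f = g)"

definition isomorphism :: "('o, 'm, 'z) category_scheme \<Rightarrow> 'm \<Rightarrow> bool" where
  "isomorphism C f \<longleftrightarrow> f \<in> arrs C \<and>
    (\<exists>g\<in>homset C (trg C f) (src C f).
      f \<Zsemi>\<^bsub>C\<^esub> g = idn C (src C f) \<and> g \<Zsemi>\<^bsub>C\<^esub> f = idn C (trg C f))"

text \<open>A functor is given by its object map \<open>Fo\<close> and its arrow map \<open>Fa\<close>.\<close>

locale cat_functor = J: category J + C: category C
  for J :: "('p, 'n, 'y) category_scheme" and C :: "('o, 'm, 'z) category_scheme" +
  fixes Fo :: "'p \<Rightarrow> 'o" and Fa :: "'n \<Rightarrow> 'm"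
  assumes Fo_in_objs: "S \<in> objs J \<Longrightarrow> Fo S \<in> objs C"
    and Fa_in_homset: "a \<in> homset J S T \<Longrightarrow> Fa a \<in> homset C (Fo S) (Fo T)"
    and Fa_idn: "S \<in> objs J \<Longrightarrow> Fa (idn J S) = idn C (Fo S)"
    and Fa_seqc: "\<lbrakk>a \<in> homset J R S; b \<in> homset J S T\<rbrakk>
      \<Longrightarrow> Fa (a \<Zsemi>\<^bsub>J\<^esub> b) = Fa a \<Zsemi>\<^bsub>C\<^esub> Fa b"

definition product_category ::
  "('o, 'm, 'z) category_scheme \<Rightarrow> ('p, 'n, 'y) category_scheme \<Rightarrow> ('o \<times> 'p, 'm \<times> 'n) category"
where
  "product_category C D =
    \<lparr>objs = objs C \<times> objs D,
     arrs = arrs C \<times> arrs D,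
     src = \<lambda>(f, g). (src C f, src D g),
     trg = \<lambda>(f, g). (trg C f, trg D g),
     idn = \<lambda>(A, B). (idn C A, idn D B),
     seqc = \<lambda>(f, g) (f', g'). (f \<Zsemi>\<^bsub>C\<^esub> f', g \<Zsemi>\<^bsub>D\<^esub> g')\<rparr>"


section \<open>Dagger categories, enrichment, monoidal structure\<close>

record ('o, 'm) dagger_category = "('o, 'm) category" +
  dag :: "'m \<Rightarrow> 'm"

locale dagger_category = category C
  for C :: "('o, 'm, 'z) dagger_category_scheme" (structure) +
  assumes dag_in_homset: "f \<in> homset C A B \<Longrightarrow> dag C f \<in> homset C B A"
    and dag_idn: "A \<in> objs C \<Longrightarrow> dag C (idn C A) = idn C A"
    and dag_seqc: "\<lbrakk>f \<in> homset C X Y; g \<in> homset C Y Z\<rbrakk>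
      \<Longrightarrow> dag C (f \<Zsemi> g) = dag C g \<Zsemi> dag C f"
    and dag_dag: "f \<in> arrs C \<Longrightarrow> dag C (dag C f) = f"

record ('o, 'm) enriched_dagger_category = "('o, 'm) dagger_category" +
  hadd :: "'m \<Rightarrow> 'm \<Rightarrow> 'm"  (infixl \<open>\<boxplus>\<index>\<close> 65)
  hzero :: "'o \<Rightarrow> 'o \<Rightarrow> 'm"

text \<open>The commutative monoid \<open>Hom(A, B)\<close>; its \<open>finprod\<close> is the finite sum of parallel arrows.\<close>

definition hom_monoid ::
  "('o, 'm, 'z) enriched_dagger_category_scheme \<Rightarrow> 'o \<Rightarrow> 'o \<Rightarrow> 'm monoid" where
  "hom_monoid C A B = \<lparr>carrier = homset C A B, monoid.mult = hadd C, one = hzero C A B\<rparr>"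

locale cmon_enriched_category = category C
  for C :: "('o, 'm, 'z) enriched_dagger_category_scheme" (structure) +
  assumes hom_comm_monoid: "\<lbrakk>A \<in> objs C; B \<in> objs C\<rbrakk> \<Longrightarrow> comm_monoid (hom_monoid C A B)"
    and hadd_seqc: "\<lbrakk>f \<in> homset C X Y; g \<in> homset C X Y; h \<in> homset C Y Z\<rbrakk>
      \<Longrightarrow> (f \<boxplus> g) \<Zsemi> h = f \<Zsemi> h \<boxplus> g \<Zsemi> h"
    and seqc_hadd: "\<lbrakk>h \<in> homset C X Y; f \<in> homset C Y Z; g \<in> homset C Y Z\<rbrakk>
      \<Longrightarrow> h \<Zsemi> (f \<boxplus> g) = h \<Zsemi> f \<boxplus> h \<Zsemi> g"
    and hzero_seqc: "\<lbrakk>X \<in> objs C; h \<in> homset C Y Z\<rbrakk> \<Longrightarrow> hzero C X Y \<Zsemi> h = hzero C X Z"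
    and seqc_hzero: "\<lbrakk>h \<in> homset C X Y; Z \<in> objs C\<rbrakk> \<Longrightarrow> h \<Zsemi> hzero C Y Z = hzero C X Z"

record ('o, 'm) monoidal_dagger_category = "('o, 'm) enriched_dagger_category" +
  tens_ob :: "'o \<Rightarrow> 'o \<Rightarrow> 'o"  (infixr \<open>\<odot>\<^sub>o\<index>\<close> 75)
  tens_ar :: "'m \<Rightarrow> 'm \<Rightarrow> 'm"  (infixr \<open>\<odot>\<^sub>a\<index>\<close> 75)
  tunit :: "'o"
  assoc :: "'o \<Rightarrow> 'o \<Rightarrow> 'o \<Rightarrow> 'm"
  lunit :: "'o \<Rightarrow> 'm"
  runit :: "'o \<Rightarrow> 'm"

locale monoidal_category = category C
  for C :: "('o, 'm, 'z) monoidal_dagger_category_scheme" (structure) +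
  assumes tunit_in_objs: "tunit C \<in> objs C"
    and tensor_functor:
      "cat_functor (product_category C C) C (\<lambda>(A, B). A \<odot>\<^sub>o B) (\<lambda>(f, g). f \<odot>\<^sub>a g)"
    and assoc_in_homset: "\<lbrakk>X \<in> objs C; Y \<in> objs C; Z \<in> objs C\<rbrakk>
      \<Longrightarrow> assoc C X Y Z \<in> homset C ((X \<odot>\<^sub>o Y) \<odot>\<^sub>o Z) (X \<odot>\<^sub>o (Y \<odot>\<^sub>o Z))"
    and lunit_in_homset: "X \<in> objs C \<Longrightarrow> lunit C X \<in> homset C (tunit C \<odot>\<^sub>o X) X"
    and runit_in_homset: "X \<in> objs C \<Longrightarrow> runit C X \<in> homset C (X \<odot>\<^sub>o tunit C) X"
    and assoc_iso: "\<lbrakk>X \<in> objs C; Y \<in> objs C; Z \<in> objs C\<rbrakk> \<Longrightarrow> isomorphism C (assoc C X Y Z)"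
    and lunit_iso: "X \<in> objs C \<Longrightarrow> isomorphism C (lunit C X)"
    and runit_iso: "X \<in> objs C \<Longrightarrow> isomorphism C (runit C X)"
    and assoc_natural:
      "\<lbrakk>f \<in> homset C X X'; g \<in> homset C Y Y'; h \<in> homset C Z Z'\<rbrakk>
      \<Longrightarrow> ((f \<odot>\<^sub>a g) \<odot>\<^sub>a h) \<Zsemi> assoc C X' Y' Z' = assoc C X Y Z \<Zsemi> (f \<odot>\<^sub>a (g \<odot>\<^sub>a h))"
    and lunit_natural: "f \<in> homset C X Y
      \<Longrightarrow> (idn C (tunit C) \<odot>\<^sub>a f) \<Zsemi> lunit C Y = lunit C X \<Zsemi> f"
    and runit_natural: "f \<in> homset C X Y
      \<Longrightarrow> (f \<odot>\<^sub>a idn C (tunit C)) \<Zsemi> runit C Y = runit C X \<Zsemi> f"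
    and pentagon: "\<lbrakk>X \<in> objs C; Y \<in> objs C; Z \<in> objs C; W \<in> objs C\<rbrakk>
      \<Longrightarrow> assoc C (X \<odot>\<^sub>o Y) Z W \<Zsemi> assoc C X Y (Z \<odot>\<^sub>o W)
        = (assoc C X Y Z \<odot>\<^sub>a idn C W) \<Zsemi> assoc C X (Y \<odot>\<^sub>o Z) W
            \<Zsemi> (idn C X \<odot>\<^sub>a assoc C Y Z W)"
    and triangle: "\<lbrakk>X \<in> objs C; Y \<in> objs C\<rbrakk>
      \<Longrightarrow> assoc C X (tunit C) Y \<Zsemi> (idn C X \<odot>\<^sub>a lunit C Y) = runit C X \<odot>\<^sub>a idn C Y"

text \<open>No compatibility between the tensor and the dagger is required.\<close>

locale monoidal_dagger_category = monoidal_category C + dagger_category C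
  for C :: "('o, 'm, 'z) monoidal_dagger_category_scheme" (structure)

definition simple_tensor_unit :: "('o, 'm, 'z) monoidal_dagger_category_scheme \<Rightarrow> bool" where
  "simple_tensor_unit C \<longleftrightarrow>
    (\<forall>A\<in>objs C. \<forall>m\<in>homset C A (tunit C).
      monic C m \<longrightarrow> m = hzero C A (tunit C) \<or> isomorphism C m)"


section \<open>Finite forest-shaped multigraphs\<close>

text \<open>Weakly connected components: the \<open>connected\<close> of the graph library refers to the
  symmetric closure.\<close>

definition weak_components :: "('v, 'e) pre_digraph \<Rightarrow> ('v, 'e) pre_digraph set" where
  "weak_components G =
    {H. induced_subgraph H G \<and> Digraph_Component.connected H \<and>
      \<not> (\<exists>H'. induced_subgraph H' G \<and> Digraph_Component.connected H' \<and> verts H \<subset> verts H')}"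

text \<open>Trees oriented towards the root: from every vertex there is exactly one directed walk to the
  root. Walks are taken as sequences of vertices, so that parallel arrows are allowed.
  The graph library's \<open>tree\<close> (connected, without directed cycles) is weaker.\<close>

definition rooted_in_tree :: "('v, 'e) pre_digraph \<Rightarrow> bool" where
  "rooted_in_tree G \<longleftrightarrow>
    (\<exists>r\<in>verts G. \<forall>v\<in>verts G. \<exists>!p. vwalk p G \<and> hd p = v \<and> last p = r)"

definition finite_forest_multigraph :: "('v, 'e) pre_digraph \<Rightarrow> bool" where
  "finite_forest_multigraph G \<longleftrightarrow> fin_digraph G \<and> (\<forall>H\<in>weak_components G. rooted_in_tree H)"

text \<open>Arrows of the free category are the directed walks, tagged with their end points.\<close>

definition free_category :: "('v, 'e) pre_digraph \<Rightarrow> ('v, 'v \<times> 'e list \<times> 'v) category" where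
  "free_category G =
    \<lparr>objs = verts G,
     arrs = {(u, p, v). pre_digraph.awalk G u p v},
     src = \<lambda>(u, p, v). u,
     trg = \<lambda>(u, p, v). v,
     idn = \<lambda>u. (u, [], u),
     seqc = \<lambda>(u, p, v) (v', q, w). (u, p @ q, w)\<rparr>"

definition leaves :: "('p, 'n, 'y) category_scheme \<Rightarrow> 'p set" where
  "leaves J = {S \<in> objs J. \<forall>a\<in>arrs J. trg J a = S \<longrightarrow> a = idn J S}"

lemma category_free_category:
  assumes "wf_digraph G"
  shows "category (free_category G)"
proof -
  interpret wf_digraph G by (fact assms)
  show ?thesis
    by unfold_locales
      (auto simp: free_category_def homset_def awalk_Nil_iff intro: awalk_appendI
        dest: awalk_hd_in_verts awalk_last_in_verts)
qed


section \<open>Dagger limits\<close>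

definition is_cone ::
  "('p, 'n, 'y) category_scheme \<Rightarrow> ('o, 'm, 'z) category_scheme \<Rightarrow> ('p \<Rightarrow> 'o) \<Rightarrow> ('n \<Rightarrow> 'm)
    \<Rightarrow> 'o \<Rightarrow> ('p \<Rightarrow> 'm) \<Rightarrow> bool" where
  "is_cone J C Fo Fa L l \<longleftrightarrow> L \<in> objs C \<and>
    (\<forall>S\<in>objs J. l S \<in> homset C L (Fo S)) \<and>
    (\<forall>a\<in>arrs J. l (src J a) \<Zsemi>\<^bsub>C\<^esub> Fa a = l (trg J a))"

definition is_limit ::
  "('p, 'n, 'y) category_scheme \<Rightarrow> ('o, 'm, 'z) category_scheme \<Rightarrow> ('p \<Rightarrow> 'o) \<Rightarrow> ('n \<Rightarrow> 'm)
    \<Rightarrow> 'o \<Rightarrow> ('p \<Rightarrow> 'm) \<Rightarrow> bool" where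
  "is_limit J C Fo Fa L l \<longleftrightarrow> is_cone J C Fo Fa L l \<and>
    (\<forall>M m. is_cone J C Fo Fa M m \<longrightarrow>
      (\<exists>!u. u \<in> homset C M L \<and> (\<forall>S\<in>objs J. u \<Zsemi>\<^bsub>C\<^esub> l S = m S)))"

definition is_dagger_limit ::
  "('p, 'n, 'y) category_scheme \<Rightarrow> ('o, 'm, 'z) enriched_dagger_category_scheme
    \<Rightarrow> ('p \<Rightarrow> 'o) \<Rightarrow> ('n \<Rightarrow> 'm) \<Rightarrow> 'o \<Rightarrow> ('p \<Rightarrow> 'm) \<Rightarrow> bool" where
  "is_dagger_limit J C Fo Fa L l \<longleftrightarrow> is_limit J C Fo Fa L l \<and>
    finprod (hom_monoid C L L) (\<lambda>S. l S \<Zsemi>\<^bsub>C\<^esub> dag C (l S)) (leaves J) = idn C L"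

text \<open>Every finite multigraph is isomorphic to one whose vertices and arrows are natural numbers,
  so these represent all shapes.\<close>

definition has_finite_dagger_limits ::
  "('o, 'm, 'z) enriched_dagger_category_scheme \<Rightarrow> bool" where
  "has_finite_dagger_limits C \<longleftrightarrow>
    (\<forall>(G :: (nat, nat) pre_digraph) Fo Fa.
      finite_forest_multigraph G \<and> cat_functor (free_category G) C Fo Fa \<longrightarrow>
      (\<exists>L l. is_dagger_limit (free_category G) C Fo Fa L l))"


section \<open>Scalars, involutions and orderability\<close>

definition scalars :: "('o, 'm, 'z) monoidal_dagger_category_scheme \<Rightarrow> 'm ring" where
  "scalars C =
    \<lparr>carrier = homset C (tunit C) (tunit C),
     monoid.mult = seqc C,
     one = idn C (tunit C),
     zero = hzero C (tunit C) (tunit C),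
     add = hadd C\<rparr>"

lemma semiring_scalars:
  assumes "monoidal_category C" "cmon_enriched_category C"
  shows "semiring (scalars C)"
proof -
  interpret M: monoidal_category C by (fact assms(1))
  interpret E: cmon_enriched_category C by (fact assms(2))
  note I = M.tunit_in_objs
  have am: "add_monoid (scalars C) = hom_monoid C (tunit C) (tunit C)"
    by (simp add: scalars_def hom_monoid_def)
  show ?thesis
  proof (intro semiring.intro abelian_monoid.intro)
    show "comm_monoid (add_monoid (scalars C))"
      unfolding am by (rule E.hom_comm_monoid[OF I I])
    show "Group.monoid (scalars C)"
      using I by (intro monoidI)
        (auto simp: scalars_def intro: M.idn_in_homset M.seqc_in_homset M.idn_seqc M.seqc_idn
          M.seqc_assoc)
    show "semiring_axioms (scalars C)"
      using I by unfold_locales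
        (auto simp: scalars_def intro: E.hadd_seqc E.seqc_hadd E.hzero_seqc E.seqc_hzero)
  qed
qed

definition involution :: "('a, 'z) ring_scheme \<Rightarrow> ('a \<Rightarrow> 'a) \<Rightarrow> bool" where
  "involution R s \<longleftrightarrow> s \<in> ring_iso R R \<and> (\<forall>x\<in>carrier R. s (s x) = x)"

text \<open>Preservation of zero is stated separately since \<open>ring_hom\<close> does not include it.\<close>

definition semiring_embedding ::
  "('a, 'z) ring_scheme \<Rightarrow> ('b, 'y) ring_scheme \<Rightarrow> ('a \<Rightarrow> 'b) \<Rightarrow> bool" where
  "semiring_embedding R S h \<longleftrightarrow>
    h \<in> ring_hom R S \<and> h \<zero>\<^bsub>R\<^esub> = \<zero>\<^bsub>S\<^esub> \<and> inj_on h (carrier R)"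

definition characteristic_zero :: "('a, 'z) ring_scheme \<Rightarrow> bool" where
  "characteristic_zero R \<longleftrightarrow> (\<forall>n::nat. n > 0 \<longrightarrow> [n] \<cdot>\<^bsub>R\<^esub> \<one>\<^bsub>R\<^esub> \<noteq> \<zero>\<^bsub>R\<^esub>)"

definition fixed_field :: "('a, 'z) ring_scheme \<Rightarrow> ('a \<Rightarrow> 'a) \<Rightarrow> ('a, 'z) ring_scheme" where
  "fixed_field K s = K\<lparr>carrier := {x \<in> carrier K. s x = x}\<rparr>"

definition orderable :: "('a, 'z) ring_scheme \<Rightarrow> bool" where
  "orderable R \<longleftrightarrow>
    (\<exists>le. linear_order_on (carrier R) le \<and>
      (\<forall>a\<in>carrier R. \<forall>b\<in>carrier R. \<forall>c\<in>carrier R.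
        (a, b) \<in> le \<longrightarrow> (a \<oplus>\<^bsub>R\<^esub> c, b \<oplus>\<^bsub>R\<^esub> c) \<in> le) \<and>
      (\<forall>a\<in>carrier R. \<forall>b\<in>carrier R.
        (\<zero>\<^bsub>R\<^esub>, a) \<in> le \<and> (\<zero>\<^bsub>R\<^esub>, b) \<in> le \<longrightarrow> (\<zero>\<^bsub>R\<^esub>, a \<otimes>\<^bsub>R\<^esub> b) \<in> le))"

end

theory Submission
  imports Defs "HOL-Algebra.Weak_Morphisms" "HOL-Algebra.Subrings"
begin

text \<open>The equaliser of two row vectors \<open>B \<oplus> B \<rightarrow> D\<close> is a split subobject, hence a self-adjoint idempotent
  2-by-2 matrix over \<open>Hom(B, B)\<close>. Solving for the entries of this matrix gives, in turn, that addition is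
  cancellative, that \<open>f f\<^sup>\<dagger> + g g\<^sup>\<dagger> = f g\<^sup>\<dagger> + g f\<^sup>\<dagger>\<close> only if \<open>f = g\<close>, and (with the simple unit) that
  \<open>a c + b d = a d + b c\<close> for scalars only if \<open>a = b\<close> or \<open>c = d\<close>. Hence the formal differences of
  scalars form an integral domain. Its norm form \<open>r r\<^sup>\<dagger>\<close> is anisotropic: a vanishing sum of
  norms is the second equation for vectors \<open>f, g\<close> into a biproduct of copies of the unit. This passes to the field of
  fractions, so the sums of norms are a preordering of its fixed field, which extends to an order by
  Artin and Schreier.\<close>

text \<open>Hom-sets have no subtraction, so each statement about a difference \<open>f - g\<close>
  is written with every term moved to the side on which it is positive. It can be read as a
  statement about differences only once addition is cancellative, which makes cancellation the first
  thing to be won from the equalisers. No axiom relates the dagger to the enrichment either: its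
  additivity is derived from the dagger biproducts. The simple unit serves to make multiplication by
  a nonzero scalar injective. To pass from there to products of differences, a single scalar has to
  stand in for \<open>c - d\<close>: the off-diagonal entry \<open>q\<close> of the matrix for the
  rows \<open>(c, d)\<close> and \<open>(d, c)\<close> does so, because it kills
  \<open>a - b\<close> whenever \<open>c - d\<close> does and vanishes only if \<open>c = d\<close>.
  A last obstacle is the type of the field: classes of pairs of classes of pairs of scalars are not
  sets of quadruples of scalars, so the field of fractions is finally copied along an
  injection.\<close>

no_notation vwalk_join (infixr \<open>\<oplus>\<close> 65)

section \<open>Difference rings and fraction fields\<close>

lemma involutionI:
  assumes "s \<in> ring_hom R R" and "\<And>x. x \<in> carrier R \<Longrightarrow> s (s x) = x"
  shows "involution R s"
proof -
  have "bij_betw s (carrier R) (carrier R)"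
    using assms by (intro bij_betw_byWitness[where f' = s]) (auto simp: ring_hom_closed)
  with assms show ?thesis by (auto simp: involution_def ring_iso_def)
qed

lemma involutionD:
  assumes "involution R s"
  shows "s \<in> ring_hom R R" "\<And>x. x \<in> carrier R \<Longrightarrow> s x \<in> carrier R"
    "\<And>x. x \<in> carrier R \<Longrightarrow> s (s x) = x"
    "\<And>x y. x \<in> carrier R \<Longrightarrow> y \<in> carrier R \<Longrightarrow> s (x \<oplus>\<^bsub>R\<^esub> y) = s x \<oplus>\<^bsub>R\<^esub> s y"
    "\<And>x y. x \<in> carrier R \<Longrightarrow> y \<in> carrier R \<Longrightarrow> s (x \<otimes>\<^bsub>R\<^esub> y) = s x \<otimes>\<^bsub>R\<^esub> s y"
    "s \<one>\<^bsub>R\<^esub> = \<one>\<^bsub>R\<^esub>"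
  using assms by (auto simp: involution_def ring_iso_def ring_hom_def)

section \<open>The ring of formal differences of a cancellative commutative semiring\<close>

locale cancel_comm_semiring = semiring R for R (structure) +
  assumes m_comm: "x \<in> carrier R \<Longrightarrow> y \<in> carrier R \<Longrightarrow> x \<otimes> y = y \<otimes> x"
    and a_cancel: "\<lbrakk>x \<in> carrier R; y \<in> carrier R; z \<in> carrier R; x \<oplus> y = x \<oplus> z\<rbrakk> \<Longrightarrow> y = z"
begin

abbreviation pairs where "pairs \<equiv> carrier R \<times> carrier R"

definition difference_rel :: "(('a \<times> 'a) \<times> ('a \<times> 'a)) set" where
  "difference_rel = {((a, b), (c, d)). a \<in> carrier R \<and> b \<in> carrier R \<and> c \<in> carrier R \<and> d \<in> carrier R
    \<and> a \<oplus> d = c \<oplus> b}"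

definition difference :: "'a \<Rightarrow> 'a \<Rightarrow> ('a \<times> 'a) set" where
  "difference a b = difference_rel `` {(a, b)}"

text \<open>The class of \<open>(a, b)\<close> plays the role of \<open>a - b\<close>; the product
  formula is \<open>(a - b) (c - d)\<close> expanded and sorted by sign.\<close>

definition difference_ring :: "('a \<times> 'a) set ring" where
  "difference_ring = \<lparr>carrier = pairs // difference_rel,
    monoid.mult = (\<lambda>X Y. \<Union>(a, b)\<in>X. \<Union>(c, d)\<in>Y. difference (a \<otimes> c \<oplus> b \<otimes> d) (a \<otimes> d \<oplus> b \<otimes> c)),
    one = difference \<one> \<zero>, zero = difference \<zero> \<zero>,
    add = (\<lambda>X Y. \<Union>(a, b)\<in>X. \<Union>(c, d)\<in>Y. difference (a \<oplus> c) (b \<oplus> d))\<rparr>"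

text \<open>Cancellation is what makes the relation transitive: after adding \<open>d\<close> to
  both sides, both hypotheses apply, and \<open>d\<close> can be removed again.\<close>

lemma equiv_difference_rel: "equiv pairs difference_rel"
proof (rule equivI)
  show "difference_rel \<subseteq> pairs \<times> pairs" "refl_on pairs difference_rel" "sym difference_rel"
    by (auto simp: difference_rel_def refl_on_def sym_def)
  show "trans difference_rel"
  proof (rule transI, clarify)
    fix a b c d e f
    assume 1: "((a, b), (c, d)) \<in> difference_rel" and 2: "((c, d), (e, f)) \<in> difference_rel"
    then have car: "a \<in> carrier R" "b \<in> carrier R" "c \<in> carrier R" "d \<in> carrier R" "e \<in> carrier R" "f \<in> carrier R"
      and e: "a \<oplus> d = c \<oplus> b" "c \<oplus> f = e \<oplus> d"
      by (auto simp: difference_rel_def)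
    have "d \<oplus> (a \<oplus> f) = (a \<oplus> d) \<oplus> f" using car by (simp add: a_ac)
    also have "\<dots> = (c \<oplus> f) \<oplus> b" unfolding e(1) using car by (simp add: a_ac)
    also have "\<dots> = d \<oplus> (e \<oplus> b)" unfolding e(2) using car by (simp add: a_ac)
    finally have "a \<oplus> f = e \<oplus> b"
      by (rule a_cancel[rotated 3]) (use car in simp_all)
    then show "((a, b), (e, f)) \<in> difference_rel"
      using car by (simp add: difference_rel_def)
  qed
qed

lemma difference_eq_iff:
  assumes "a \<in> carrier R" "b \<in> carrier R" "c \<in> carrier R" "d \<in> carrier R"
  shows "difference a b = difference c d \<longleftrightarrow> a \<oplus> d = c \<oplus> b"
  using assms eq_equiv_class_iff[OF equiv_difference_rel, of "(a, b)" "(c, d)"]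
  by (simp add: difference_def difference_rel_def)

lemma difference_mem [simp]:
  "\<lbrakk>a \<in> carrier R; b \<in> carrier R\<rbrakk> \<Longrightarrow> difference a b \<in> carrier difference_ring"
  by (auto simp: difference_ring_def difference_def intro: quotientI)

lemma difference_cases:
  assumes "x \<in> carrier difference_ring"
  obtains a b where "a \<in> carrier R" "b \<in> carrier R" "x = difference a b"
  using assms by (auto simp: difference_ring_def difference_def elim!: quotientE)

lemma difference_add [simp]:
  assumes "a \<in> carrier R" "b \<in> carrier R" "c \<in> carrier R" "d \<in> carrier R"
  shows "difference a b \<oplus>\<^bsub>difference_ring\<^esub> difference c d = difference (a \<oplus> c) (b \<oplus> d)"
proof -
  have "congruent2 difference_rel difference_rel (\<lambda>(a, b) (c, d). difference (a \<oplus> c) (b \<oplus> d))"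
  proof (rule congruent2_commuteI[OF equiv_difference_rel])
    fix p q assume "p \<in> pairs" "q \<in> pairs"
    then show "(case p of (a, b) \<Rightarrow> \<lambda>(c, d). difference (a \<oplus> c) (b \<oplus> d)) q =
        (case q of (a, b) \<Rightarrow> \<lambda>(c, d). difference (a \<oplus> c) (b \<oplus> d)) p"
      by (auto simp: a_comm)
  next
    fix p q r assume "p \<in> pairs" "(q, r) \<in> difference_rel"
    moreover obtain a b c d e f where "p = (e, f)" "q = (a, b)" "r = (c, d)" by (metis prod.exhaust)
    ultimately have car: "a \<in> carrier R" "b \<in> carrier R" "c \<in> carrier R" "d \<in> carrier R" "e \<in> carrier R" "f \<in> carrier R"
      and e: "a \<oplus> d = c \<oplus> b" and eq: "p = (e, f)" "q = (a, b)" "r = (c, d)"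
      by (auto simp: difference_rel_def)
    have "e \<oplus> a \<oplus> (f \<oplus> d) = e \<oplus> f \<oplus> (a \<oplus> d)" using car by (simp add: a_ac)
    also have "\<dots> = e \<oplus> c \<oplus> (f \<oplus> b)" unfolding e using car by (simp add: a_ac)
    finally show "(case p of (a, b) \<Rightarrow> \<lambda>(c, d). difference (a \<oplus> c) (b \<oplus> d)) q =
        (case p of (a, b) \<Rightarrow> \<lambda>(c, d). difference (a \<oplus> c) (b \<oplus> d)) r"
      using car by (simp add: eq difference_eq_iff)
  qed
  from UN_equiv_class2[OF equiv_difference_rel equiv_difference_rel this, of "(a, b)" "(c, d)"] assms
  show ?thesis by (simp add: difference_ring_def difference_def[of a b] difference_def[of c d] split_def)
qed

lemma difference_mult [simp]:
  assumes "a \<in> carrier R" "b \<in> carrier R" "c \<in> carrier R" "d \<in> carrier R"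
  shows "difference a b \<otimes>\<^bsub>difference_ring\<^esub> difference c d
    = difference (a \<otimes> c \<oplus> b \<otimes> d) (a \<otimes> d \<oplus> b \<otimes> c)"
proof -
  let ?m = "\<lambda>(a, b) (c, d). difference (a \<otimes> c \<oplus> b \<otimes> d) (a \<otimes> d \<oplus> b \<otimes> c)"
  have "congruent2 difference_rel difference_rel ?m"
  proof (rule congruent2_commuteI[OF equiv_difference_rel])
    fix p q assume "p \<in> pairs" "q \<in> pairs"
    then show "?m p q = ?m q p"
      by (auto simp: m_comm a_comm)
  next
    fix p q r assume "p \<in> pairs" "(q, r) \<in> difference_rel"
    moreover obtain a b c d e f where "p = (e, f)" "q = (a, b)" "r = (c, d)" by (metis prod.exhaust)
    ultimately have car: "a \<in> carrier R" "b \<in> carrier R" "c \<in> carrier R" "d \<in> carrier R" "e \<in> carrier R" "f \<in> carrier R"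
      and e: "a \<oplus> d = c \<oplus> b" and eq: "p = (e, f)" "q = (a, b)" "r = (c, d)"
      by (auto simp: difference_rel_def)
    have "(e \<otimes> a \<oplus> f \<otimes> b) \<oplus> (e \<otimes> d \<oplus> f \<otimes> c) = e \<otimes> (a \<oplus> d) \<oplus> f \<otimes> (c \<oplus> b)"
      using car by (simp add: r_distr a_ac)
    also have "\<dots> = e \<otimes> (c \<oplus> b) \<oplus> f \<otimes> (a \<oplus> d)" by (simp add: e)
    also have "\<dots> = (e \<otimes> c \<oplus> f \<otimes> d) \<oplus> (e \<otimes> b \<oplus> f \<otimes> a)"
      using car by (simp add: r_distr a_ac)
    finally show "?m p q = ?m p r"
      using car by (simp add: eq difference_eq_iff)
  qed
  from UN_equiv_class2[OF equiv_difference_rel equiv_difference_rel this, of "(a, b)" "(c, d)"] assms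
  show ?thesis by (simp add: difference_ring_def difference_def[of a b] difference_def[of c d] split_def)
qed

lemma difference_one_zero:
  "\<one>\<^bsub>difference_ring\<^esub> = difference \<one> \<zero>" "\<zero>\<^bsub>difference_ring\<^esub> = difference \<zero> \<zero>"
  by (simp_all add: difference_ring_def)

lemma difference_ring_axioms:
  assumes "x \<in> carrier difference_ring" "y \<in> carrier difference_ring" "z \<in> carrier difference_ring"
  shows "x \<oplus>\<^bsub>difference_ring\<^esub> y \<in> carrier difference_ring"
    and "x \<otimes>\<^bsub>difference_ring\<^esub> y \<in> carrier difference_ring"
    and "(x \<oplus>\<^bsub>difference_ring\<^esub> y) \<oplus>\<^bsub>difference_ring\<^esub> z = x \<oplus>\<^bsub>difference_ring\<^esub> (y \<oplus>\<^bsub>difference_ring\<^esub> z)"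
    and "x \<oplus>\<^bsub>difference_ring\<^esub> y = y \<oplus>\<^bsub>difference_ring\<^esub> x"
    and "\<zero>\<^bsub>difference_ring\<^esub> \<oplus>\<^bsub>difference_ring\<^esub> x = x"
    and "\<exists>u\<in>carrier difference_ring. u \<oplus>\<^bsub>difference_ring\<^esub> x = \<zero>\<^bsub>difference_ring\<^esub>"
    and "(x \<otimes>\<^bsub>difference_ring\<^esub> y) \<otimes>\<^bsub>difference_ring\<^esub> z = x \<otimes>\<^bsub>difference_ring\<^esub> (y \<otimes>\<^bsub>difference_ring\<^esub> z)"
    and "x \<otimes>\<^bsub>difference_ring\<^esub> y = y \<otimes>\<^bsub>difference_ring\<^esub> x"
    and "\<one>\<^bsub>difference_ring\<^esub> \<otimes>\<^bsub>difference_ring\<^esub> x = x"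
    and "(x \<oplus>\<^bsub>difference_ring\<^esub> y) \<otimes>\<^bsub>difference_ring\<^esub> z =
      x \<otimes>\<^bsub>difference_ring\<^esub> z \<oplus>\<^bsub>difference_ring\<^esub> y \<otimes>\<^bsub>difference_ring\<^esub> z"
proof -
  obtain a b where x: "a \<in> carrier R" "b \<in> carrier R" "x = difference a b"
    using assms(1) by (rule difference_cases)
  obtain c d where y: "c \<in> carrier R" "d \<in> carrier R" "y = difference c d"
    using assms(2) by (rule difference_cases)
  obtain e f where z: "e \<in> carrier R" "f \<in> carrier R" "z = difference e f"
    using assms(3) by (rule difference_cases)
  note car = x(1,2) y(1,2) z(1,2)
  show "x \<oplus>\<^bsub>difference_ring\<^esub> y \<in> carrier difference_ring"
    and "x \<otimes>\<^bsub>difference_ring\<^esub> y \<in> carrier difference_ring"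
    and "\<zero>\<^bsub>difference_ring\<^esub> \<oplus>\<^bsub>difference_ring\<^esub> x = x"
    and "\<one>\<^bsub>difference_ring\<^esub> \<otimes>\<^bsub>difference_ring\<^esub> x = x"
    using car by (simp_all add: x(3) y(3) z(3) difference_one_zero)
  show "(x \<oplus>\<^bsub>difference_ring\<^esub> y) \<oplus>\<^bsub>difference_ring\<^esub> z = x \<oplus>\<^bsub>difference_ring\<^esub> (y \<oplus>\<^bsub>difference_ring\<^esub> z)"
    using car by (simp add: x(3) y(3) z(3) a_assoc)
  show "x \<oplus>\<^bsub>difference_ring\<^esub> y = y \<oplus>\<^bsub>difference_ring\<^esub> x"
    using car by (simp add: x(3) y(3) a_comm)
  have "difference b a \<oplus>\<^bsub>difference_ring\<^esub> x = \<zero>\<^bsub>difference_ring\<^esub>"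
    using car by (simp add: x(3) difference_one_zero difference_eq_iff a_comm)
  then show "\<exists>u\<in>carrier difference_ring. u \<oplus>\<^bsub>difference_ring\<^esub> x = \<zero>\<^bsub>difference_ring\<^esub>"
    by (rule bexI) (use car in simp)
  show "x \<otimes>\<^bsub>difference_ring\<^esub> y = y \<otimes>\<^bsub>difference_ring\<^esub> x"
    using car by (simp add: x(3) y(3) m_comm a_comm)
  show "(x \<otimes>\<^bsub>difference_ring\<^esub> y) \<otimes>\<^bsub>difference_ring\<^esub> z = x \<otimes>\<^bsub>difference_ring\<^esub> (y \<otimes>\<^bsub>difference_ring\<^esub> z)"
    using car by (simp add: x(3) y(3) z(3) l_distr r_distr m_assoc a_ac)
  show "(x \<oplus>\<^bsub>difference_ring\<^esub> y) \<otimes>\<^bsub>difference_ring\<^esub> z =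
      x \<otimes>\<^bsub>difference_ring\<^esub> z \<oplus>\<^bsub>difference_ring\<^esub> y \<otimes>\<^bsub>difference_ring\<^esub> z"
    using car by (simp add: x(3) y(3) z(3) l_distr a_ac)
qed

lemma cring_difference_ring: "cring difference_ring"
proof (rule cringI)
  have zo: "\<zero>\<^bsub>difference_ring\<^esub> \<in> carrier difference_ring" "\<one>\<^bsub>difference_ring\<^esub> \<in> carrier difference_ring"
    by (simp_all add: difference_one_zero)
  show "abelian_group difference_ring"
    using zo difference_ring_axioms by (intro abelian_groupI) 
  show "comm_monoid difference_ring"
    using zo difference_ring_axioms by (intro comm_monoidI)
qed (rule difference_ring_axioms)

lemma difference_embed:
  "(\<lambda>a. difference a \<zero>) \<in> ring_hom R difference_ring" "inj_on (\<lambda>a. difference a \<zero>) (carrier R)"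
  by (auto simp: ring_hom_def difference_one_zero inj_on_def difference_eq_iff)

lemma difference_involution:
  assumes s: "involution R s"
  obtains s' where "involution difference_ring s'"
    and "\<forall>a\<in>carrier R. \<forall>b\<in>carrier R. s' (difference a b) = difference (s a) (s b)"
proof -
  let ?f = "\<lambda>(a, b). difference (s a) (s b)"
  define s' where "s' X = (\<Union>p\<in>X. ?f p)" for X
  note sD = involutionD[OF s]
  have "congruent difference_rel ?f"
  proof (rule congruentI, clarify)
    fix a b c d assume "((a, b), (c, d)) \<in> difference_rel"
    then have car: "a \<in> carrier R" "b \<in> carrier R" "c \<in> carrier R" "d \<in> carrier R" and "a \<oplus> d = c \<oplus> b"
      by (auto simp: difference_rel_def)
    then have "s (a \<oplus> d) = s (c \<oplus> b)" by simp
    then show "difference (s a) (s b) = difference (s c) (s d)" using car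
      by (simp add: difference_eq_iff sD)
  qed
  then have ext: "s' (difference a b) = difference (s a) (s b)" if "a \<in> carrier R" "b \<in> carrier R" for a b
    using UN_equiv_class[OF equiv_difference_rel, of ?f "(a, b)"] that
    by (simp add: difference_def[of a b] s'_def)
  \<comment> \<open>\<open>ring_hom\<close> does not include preservation of zero; here it follows
    from additivity and cancellation.\<close>
  have "s \<zero> \<oplus> s \<zero> = s \<zero> \<oplus> \<zero>" using sD(4)[of \<zero> \<zero>] by (simp add: sD(2))
  then have s0: "s \<zero> = \<zero>" by (rule a_cancel[rotated 3]) (simp_all add: sD(2))
  have "involution difference_ring s'"
  proof (rule involutionI)
    show "s' \<in> ring_hom difference_ring difference_ring"
      by (rule ring_hom_memI; (elim difference_cases)?; simp add: ext sD s0 difference_one_zero)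
    show "s' (s' x) = x" if "x \<in> carrier difference_ring" for x
      using that by (elim difference_cases) (simp add: ext sD)
  qed
  with ext that show ?thesis by blast
qed

end

section \<open>The field of fractions of an integral domain\<close>

context domain
begin

lemma mult_nonzero: "\<lbrakk>a \<in> carrier R; b \<in> carrier R; a \<noteq> \<zero>; b \<noteq> \<zero>\<rbrakk> \<Longrightarrow> a \<otimes> b \<noteq> \<zero>"
  using integral_iff by simp

abbreviation "fraction_pairs \<equiv> carrier R \<times> (carrier R - {\<zero>})"

definition fraction_rel :: "(('a \<times> 'a) \<times> ('a \<times> 'a)) set" where
  "fraction_rel = {((a, b), (c, d)). a \<in> carrier R \<and> b \<in> carrier R - {\<zero>} \<and> c \<in> carrier R \<and>
    d \<in> carrier R - {\<zero>} \<and> a \<otimes> d = c \<otimes> b}"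

definition fraction :: "'a \<Rightarrow> 'a \<Rightarrow> ('a \<times> 'a) set" where
  "fraction a b = fraction_rel `` {(a, b)}"

definition fraction_field :: "('a \<times> 'a) set ring" where
  "fraction_field = \<lparr>carrier = fraction_pairs // fraction_rel,
    monoid.mult = (\<lambda>X Y. \<Union>(a, b)\<in>X. \<Union>(c, d)\<in>Y. fraction (a \<otimes> c) (b \<otimes> d)),
    one = fraction \<one> \<one>, zero = fraction \<zero> \<one>,
    add = (\<lambda>X Y. \<Union>(a, b)\<in>X. \<Union>(c, d)\<in>Y. fraction (a \<otimes> d \<oplus> c \<otimes> b) (b \<otimes> d))\<rparr>"

lemma equiv_fraction_rel: "equiv fraction_pairs fraction_rel"
proof (rule equivI)
  show "fraction_rel \<subseteq> fraction_pairs \<times> fraction_pairs" "refl_on fraction_pairs fraction_rel"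
    "sym fraction_rel"
    by (auto simp: fraction_rel_def refl_on_def sym_def)
  show "trans fraction_rel"
  proof (rule transI, clarify)
    fix a b c d e f
    assume 1: "((a, b), (c, d)) \<in> fraction_rel" and 2: "((c, d), (e, f)) \<in> fraction_rel"
    then have car: "a \<in> carrier R" "b \<in> carrier R" "c \<in> carrier R" "d \<in> carrier R" "e \<in> carrier R" "f \<in> carrier R"
      and nz: "b \<noteq> \<zero>" "d \<noteq> \<zero>" "f \<noteq> \<zero>" and e: "a \<otimes> d = c \<otimes> b" "c \<otimes> f = e \<otimes> d"
      by (auto simp: fraction_rel_def)
    have "d \<otimes> (a \<otimes> f) = (a \<otimes> d) \<otimes> f" using car by (simp add: m_ac)
    also have "\<dots> = (c \<otimes> f) \<otimes> b" unfolding e(1) using car by (simp add: m_ac)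
    also have "\<dots> = d \<otimes> (e \<otimes> b)" unfolding e(2) using car by (simp add: m_ac)
    finally have "a \<otimes> f = e \<otimes> b" using m_lcancel[OF nz(2)] car by simp
    then show "((a, b), (e, f)) \<in> fraction_rel"
      using car nz by (simp add: fraction_rel_def)
  qed
qed

lemma fraction_eq_iff:
  assumes "a \<in> carrier R" "b \<in> carrier R" "c \<in> carrier R" "d \<in> carrier R" "b \<noteq> \<zero>" "d \<noteq> \<zero>"
  shows "fraction a b = fraction c d \<longleftrightarrow> a \<otimes> d = c \<otimes> b"
  using assms eq_equiv_class_iff[OF equiv_fraction_rel, of "(a, b)" "(c, d)"]
  by (simp add: fraction_def fraction_rel_def)

lemma fraction_mem [simp]:
  "\<lbrakk>a \<in> carrier R; b \<in> carrier R; b \<noteq> \<zero>\<rbrakk> \<Longrightarrow> fraction a b \<in> carrier fraction_field"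
  by (auto simp: fraction_field_def fraction_def intro: quotientI)

lemma fraction_cases:
  assumes "x \<in> carrier fraction_field"
  obtains a b where "a \<in> carrier R" "b \<in> carrier R" "b \<noteq> \<zero>" "x = fraction a b"
  using assms by (auto simp: fraction_field_def fraction_def elim!: quotientE)

lemma fraction_add [simp]:
  assumes "a \<in> carrier R" "b \<in> carrier R" "c \<in> carrier R" "d \<in> carrier R" "b \<noteq> \<zero>" "d \<noteq> \<zero>"
  shows "fraction a b \<oplus>\<^bsub>fraction_field\<^esub> fraction c d = fraction (a \<otimes> d \<oplus> c \<otimes> b) (b \<otimes> d)"
proof -
  let ?m = "\<lambda>(a, b) (c, d). fraction (a \<otimes> d \<oplus> c \<otimes> b) (b \<otimes> d)"
  have "congruent2 fraction_rel fraction_rel ?m"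
  proof (rule congruent2_commuteI[OF equiv_fraction_rel])
    fix p q assume "p \<in> fraction_pairs" "q \<in> fraction_pairs"
    then show "?m p q = ?m q p"
      by (auto simp: m_comm a_comm)
  next
    fix p q r assume "p \<in> fraction_pairs" "(q, r) \<in> fraction_rel"
    moreover obtain a b c d e f where "p = (e, f)" "q = (a, b)" "r = (c, d)" by (metis prod.exhaust)
    ultimately have car: "a \<in> carrier R" "b \<in> carrier R" "c \<in> carrier R" "d \<in> carrier R" "e \<in> carrier R" "f \<in> carrier R"
      and nz: "b \<noteq> \<zero>" "d \<noteq> \<zero>" "f \<noteq> \<zero>"
      and e: "a \<otimes> d = c \<otimes> b" and eq: "p = (e, f)" "q = (a, b)" "r = (c, d)"
      by (auto simp: fraction_rel_def)
    have "(e \<otimes> b \<oplus> a \<otimes> f) \<otimes> (f \<otimes> d) = e \<otimes> f \<otimes> b \<otimes> d \<oplus> (f \<otimes> f) \<otimes> (a \<otimes> d)"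
      using car by (simp add: l_distr r_distr m_ac)
    also have "\<dots> = (e \<otimes> d \<oplus> c \<otimes> f) \<otimes> (f \<otimes> b)"
      unfolding e using car by (simp add: l_distr r_distr m_ac)
    finally show "?m p q = ?m p r"
      using car nz by (simp add: eq fraction_eq_iff mult_nonzero)
  qed
  from UN_equiv_class2[OF equiv_fraction_rel equiv_fraction_rel this, of "(a, b)" "(c, d)"] assms
  show ?thesis by (simp add: fraction_field_def fraction_def[of a b] fraction_def[of c d] split_def)
qed

lemma fraction_mult [simp]:
  assumes "a \<in> carrier R" "b \<in> carrier R" "c \<in> carrier R" "d \<in> carrier R" "b \<noteq> \<zero>" "d \<noteq> \<zero>"
  shows "fraction a b \<otimes>\<^bsub>fraction_field\<^esub> fraction c d = fraction (a \<otimes> c) (b \<otimes> d)"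
proof -
  let ?m = "\<lambda>(a, b) (c, d). fraction (a \<otimes> c) (b \<otimes> d)"
  have "congruent2 fraction_rel fraction_rel ?m"
  proof (rule congruent2_commuteI[OF equiv_fraction_rel])
    fix p q assume "p \<in> fraction_pairs" "q \<in> fraction_pairs"
    then show "?m p q = ?m q p"
      by (auto simp: m_comm)
  next
    fix p q r assume "p \<in> fraction_pairs" "(q, r) \<in> fraction_rel"
    moreover obtain a b c d e f where "p = (e, f)" "q = (a, b)" "r = (c, d)" by (metis prod.exhaust)
    ultimately have car: "a \<in> carrier R" "b \<in> carrier R" "c \<in> carrier R" "d \<in> carrier R" "e \<in> carrier R" "f \<in> carrier R"
      and nz: "b \<noteq> \<zero>" "d \<noteq> \<zero>" "f \<noteq> \<zero>"
      and e: "a \<otimes> d = c \<otimes> b" and eq: "p = (e, f)" "q = (a, b)" "r = (c, d)"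
      by (auto simp: fraction_rel_def)
    have "(e \<otimes> a) \<otimes> (f \<otimes> d) = e \<otimes> f \<otimes> (a \<otimes> d)" using car by (simp add: m_ac)
    also have "\<dots> = (e \<otimes> c) \<otimes> (f \<otimes> b)" unfolding e using car by (simp add: m_ac)
    finally show "?m p q = ?m p r"
      using car nz by (simp add: eq fraction_eq_iff mult_nonzero)
  qed
  from UN_equiv_class2[OF equiv_fraction_rel equiv_fraction_rel this, of "(a, b)" "(c, d)"] assms
  show ?thesis by (simp add: fraction_field_def fraction_def[of a b] fraction_def[of c d] split_def)
qed

lemma fraction_one_zero:
  "\<one>\<^bsub>fraction_field\<^esub> = fraction \<one> \<one>" "\<zero>\<^bsub>fraction_field\<^esub> = fraction \<zero> \<one>"
  by (simp_all add: fraction_field_def)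

lemma fraction_field_axioms:
  assumes "x \<in> carrier fraction_field" "y \<in> carrier fraction_field" "z \<in> carrier fraction_field"
  shows "x \<oplus>\<^bsub>fraction_field\<^esub> y \<in> carrier fraction_field"
    and "x \<otimes>\<^bsub>fraction_field\<^esub> y \<in> carrier fraction_field"
    and "(x \<oplus>\<^bsub>fraction_field\<^esub> y) \<oplus>\<^bsub>fraction_field\<^esub> z = x \<oplus>\<^bsub>fraction_field\<^esub> (y \<oplus>\<^bsub>fraction_field\<^esub> z)"
    and "x \<oplus>\<^bsub>fraction_field\<^esub> y = y \<oplus>\<^bsub>fraction_field\<^esub> x"
    and "\<zero>\<^bsub>fraction_field\<^esub> \<oplus>\<^bsub>fraction_field\<^esub> x = x"
    and "\<exists>u\<in>carrier fraction_field. u \<oplus>\<^bsub>fraction_field\<^esub> x = \<zero>\<^bsub>fraction_field\<^esub>"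
    and "(x \<otimes>\<^bsub>fraction_field\<^esub> y) \<otimes>\<^bsub>fraction_field\<^esub> z = x \<otimes>\<^bsub>fraction_field\<^esub> (y \<otimes>\<^bsub>fraction_field\<^esub> z)"
    and "x \<otimes>\<^bsub>fraction_field\<^esub> y = y \<otimes>\<^bsub>fraction_field\<^esub> x"
    and "\<one>\<^bsub>fraction_field\<^esub> \<otimes>\<^bsub>fraction_field\<^esub> x = x"
    and "(x \<oplus>\<^bsub>fraction_field\<^esub> y) \<otimes>\<^bsub>fraction_field\<^esub> z =
      x \<otimes>\<^bsub>fraction_field\<^esub> z \<oplus>\<^bsub>fraction_field\<^esub> y \<otimes>\<^bsub>fraction_field\<^esub> z"
    and "x \<noteq> \<zero>\<^bsub>fraction_field\<^esub> \<Longrightarrow> \<exists>u\<in>carrier fraction_field. x \<otimes>\<^bsub>fraction_field\<^esub> u = \<one>\<^bsub>fraction_field\<^esub>"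
proof -
  obtain a b where x: "a \<in> carrier R" "b \<in> carrier R" "b \<noteq> \<zero>" "x = fraction a b"
    using assms(1) by (rule fraction_cases)
  obtain c d where y: "c \<in> carrier R" "d \<in> carrier R" "d \<noteq> \<zero>" "y = fraction c d"
    using assms(2) by (rule fraction_cases)
  obtain e f where z: "e \<in> carrier R" "f \<in> carrier R" "f \<noteq> \<zero>" "z = fraction e f"
    using assms(3) by (rule fraction_cases)
  note car = x(1-3) y(1-3) z(1-3)
  note xyz = x(4) y(4) z(4)
  show "x \<oplus>\<^bsub>fraction_field\<^esub> y \<in> carrier fraction_field"
    and "x \<otimes>\<^bsub>fraction_field\<^esub> y \<in> carrier fraction_field"
    and "\<zero>\<^bsub>fraction_field\<^esub> \<oplus>\<^bsub>fraction_field\<^esub> x = x"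
    and "\<one>\<^bsub>fraction_field\<^esub> \<otimes>\<^bsub>fraction_field\<^esub> x = x"
    using car by (simp_all add: xyz fraction_one_zero mult_nonzero)
  show "(x \<oplus>\<^bsub>fraction_field\<^esub> y) \<oplus>\<^bsub>fraction_field\<^esub> z = x \<oplus>\<^bsub>fraction_field\<^esub> (y \<oplus>\<^bsub>fraction_field\<^esub> z)"
    using car by (simp add: xyz mult_nonzero l_distr r_distr a_assoc m_ac)
  show "x \<oplus>\<^bsub>fraction_field\<^esub> y = y \<oplus>\<^bsub>fraction_field\<^esub> x"
    using car by (simp add: xyz a_comm m_comm)
  have "fraction (\<ominus> a) b \<oplus>\<^bsub>fraction_field\<^esub> x = \<zero>\<^bsub>fraction_field\<^esub>"
    using car by (simp add: xyz fraction_one_zero fraction_eq_iff mult_nonzero l_minus l_neg)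
  then show "\<exists>u\<in>carrier fraction_field. u \<oplus>\<^bsub>fraction_field\<^esub> x = \<zero>\<^bsub>fraction_field\<^esub>"
    by (rule bexI) (use car in simp)
  show "x \<otimes>\<^bsub>fraction_field\<^esub> y = y \<otimes>\<^bsub>fraction_field\<^esub> x"
    using car by (simp add: xyz m_comm)
  show "(x \<otimes>\<^bsub>fraction_field\<^esub> y) \<otimes>\<^bsub>fraction_field\<^esub> z = x \<otimes>\<^bsub>fraction_field\<^esub> (y \<otimes>\<^bsub>fraction_field\<^esub> z)"
    using car by (simp add: xyz mult_nonzero m_assoc)
  have "(a \<otimes> d \<oplus> c \<otimes> b) \<otimes> e \<otimes> (b \<otimes> f \<otimes> (d \<otimes> f)) =
      (a \<otimes> e \<otimes> (d \<otimes> f) \<oplus> c \<otimes> e \<otimes> (b \<otimes> f)) \<otimes> (b \<otimes> d \<otimes> f)"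
    using car by (simp add: l_distr r_distr m_ac)
  then show "(x \<oplus>\<^bsub>fraction_field\<^esub> y) \<otimes>\<^bsub>fraction_field\<^esub> z =
      x \<otimes>\<^bsub>fraction_field\<^esub> z \<oplus>\<^bsub>fraction_field\<^esub> y \<otimes>\<^bsub>fraction_field\<^esub> z"
    using car by (simp add: xyz fraction_eq_iff mult_nonzero)
  assume "x \<noteq> \<zero>\<^bsub>fraction_field\<^esub>"
  then have "a \<noteq> \<zero>" using car by (auto simp: xyz fraction_one_zero fraction_eq_iff)
  then have "fraction b a \<in> carrier fraction_field" "x \<otimes>\<^bsub>fraction_field\<^esub> fraction b a = \<one>\<^bsub>fraction_field\<^esub>"
    using car by (simp_all add: xyz fraction_one_zero fraction_eq_iff mult_nonzero m_comm)
  then show "\<exists>u\<in>carrier fraction_field. x \<otimes>\<^bsub>fraction_field\<^esub> u = \<one>\<^bsub>fraction_field\<^esub>" by blast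
qed

lemma field_fraction_field: "field fraction_field"
proof -
  have zo: "\<zero>\<^bsub>fraction_field\<^esub> \<in> carrier fraction_field" "\<one>\<^bsub>fraction_field\<^esub> \<in> carrier fraction_field"
    by (simp_all add: fraction_one_zero)
  interpret F: cring fraction_field
  proof (rule cringI)
    show "abelian_group fraction_field"
      using zo fraction_field_axioms by (intro abelian_groupI)
    show "comm_monoid fraction_field"
      using zo fraction_field_axioms by (intro comm_monoidI)
  qed (rule fraction_field_axioms)
  show ?thesis
  proof (rule F.cring_fieldI2)
    show "\<zero>\<^bsub>fraction_field\<^esub> \<noteq> \<one>\<^bsub>fraction_field\<^esub>" by (simp add: fraction_one_zero fraction_eq_iff)
  qed (rule fraction_field_axioms)
qed

lemma fraction_embed:
  "(\<lambda>a. fraction a \<one>) \<in> ring_hom R fraction_field" "inj_on (\<lambda>a. fraction a \<one>) (carrier R)"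
  by (auto simp: ring_hom_def fraction_one_zero inj_on_def fraction_eq_iff)

text \<open>Existence of denominators, phrased without classes of pairs, so that it makes sense in
  any isomorphic copy of the field.\<close>

lemma fraction_mult_denominator:
  assumes "x \<in> carrier fraction_field"
  obtains a b where "a \<in> carrier R" "b \<in> carrier R - {\<zero>}" "x \<otimes>\<^bsub>fraction_field\<^esub> fraction b \<one> = fraction a \<one>"
proof -
  obtain a b where x: "a \<in> carrier R" "b \<in> carrier R" "b \<noteq> \<zero>" "x = fraction a b"
    using assms by (rule fraction_cases)
  then have "x \<otimes>\<^bsub>fraction_field\<^esub> fraction b \<one> = fraction a \<one>"
    by (simp add: fraction_eq_iff)
  with x that show ?thesis by blast
qed

lemma fraction_involution:
  assumes s: "involution R s"
  obtains s' where "involution fraction_field s'"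
    and "\<forall>a\<in>carrier R. s' (fraction a \<one>) = fraction (s a) \<one>"
proof -
  let ?f = "\<lambda>(a, b). fraction (s a) (s b)"
  define s' where "s' X = (\<Union>p\<in>X. ?f p)" for X
  note sD = involutionD[OF s]
  have s0: "s \<zero> = \<zero>" using ring_hom_zero[OF sD(1)] ring_axioms by blast
  have nz: "s b \<noteq> \<zero>" if "b \<in> carrier R" "b \<noteq> \<zero>" for b
    using sD(3)[OF that(1)] that(2) s0 by auto
  have "congruent fraction_rel ?f"
  proof (rule congruentI, clarify)
    fix a b c d assume "((a, b), (c, d)) \<in> fraction_rel"
    then have car: "a \<in> carrier R" "b \<in> carrier R" "c \<in> carrier R" "d \<in> carrier R" "b \<noteq> \<zero>" "d \<noteq> \<zero>"
      and "a \<otimes> d = c \<otimes> b"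
      by (auto simp: fraction_rel_def)
    then have "s (a \<otimes> d) = s (c \<otimes> b)" by simp
    then show "fraction (s a) (s b) = fraction (s c) (s d)" using car
      by (simp add: fraction_eq_iff sD nz)
  qed
  then have ext: "s' (fraction a b) = fraction (s a) (s b)"
    if "a \<in> carrier R" "b \<in> carrier R" "b \<noteq> \<zero>" for a b
    using UN_equiv_class[OF equiv_fraction_rel, of ?f "(a, b)"] that
    by (simp add: fraction_def[of a b] s'_def)
  have "involution fraction_field s'"
  proof (rule involutionI)
    show "s' \<in> ring_hom fraction_field fraction_field"
      by (rule ring_hom_memI; (elim fraction_cases)?; simp add: ext sD s0 nz mult_nonzero fraction_one_zero)
    show "s' (s' x) = x" if "x \<in> carrier fraction_field" for x
      using that by (elim fraction_cases) (simp add: ext sD nz)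
  qed
  with ext sD that show ?thesis by simp
qed

end

section \<open>Orderings and sums of norms\<close>

text \<open>Artin and Schreier: a maximal preordering is the cone of nonnegative elements of an order.\<close>

definition field_preordering :: "('a, 'b) ring_scheme \<Rightarrow> 'a set \<Rightarrow> bool" where
  "field_preordering R P \<longleftrightarrow> P \<subseteq> carrier R \<and> (\<forall>a\<in>carrier R. a \<otimes>\<^bsub>R\<^esub> a \<in> P) \<and>
    (\<forall>x\<in>P. \<forall>y\<in>P. x \<oplus>\<^bsub>R\<^esub> y \<in> P \<and> x \<otimes>\<^bsub>R\<^esub> y \<in> P) \<and> (\<forall>x\<in>P. x \<oplus>\<^bsub>R\<^esub> \<one>\<^bsub>R\<^esub> \<noteq> \<zero>\<^bsub>R\<^esub>)"

lemma preordering_Union_chain: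
  assumes "\<C> \<noteq> {}" and chain: "subset.chain {P. field_preordering R P} \<C>"
  shows "field_preordering R (\<Union>\<C>)"
proof -
  have pre: "field_preordering R P" if "P \<in> \<C>" for P
    using chain that by (auto simp: subset.chain_def)
  have common: "\<exists>P\<in>\<C>. x \<in> P \<and> y \<in> P" if xy: "x \<in> \<Union>\<C>" "y \<in> \<Union>\<C>" for x y
  proof -
    obtain P Q where PQ: "P \<in> \<C>" "Q \<in> \<C>" "x \<in> P" "y \<in> Q" using xy by blast
    then have "P \<subseteq> Q \<or> Q \<subseteq> P" using chain unfolding subset_chain_def by blast
    with PQ show ?thesis by blast
  qed
  have "x \<oplus>\<^bsub>R\<^esub> y \<in> \<Union>\<C> \<and> x \<otimes>\<^bsub>R\<^esub> y \<in> \<Union>\<C>" if xy: "x \<in> \<Union>\<C>" "y \<in> \<Union>\<C>" for x y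
  proof -
    obtain P where "P \<in> \<C>" "x \<in> P" "y \<in> P" using common[OF xy] by blast
    then show ?thesis using pre[of P] unfolding field_preordering_def by blast
  qed
  moreover have "a \<otimes>\<^bsub>R\<^esub> a \<in> \<Union>\<C>" if "a \<in> carrier R" for a
    using pre \<open>\<C> \<noteq> {}\<close> that unfolding field_preordering_def by blast
  moreover have "\<Union>\<C> \<subseteq> carrier R" "\<forall>x\<in>\<Union>\<C>. x \<oplus>\<^bsub>R\<^esub> \<one>\<^bsub>R\<^esub> \<noteq> \<zero>\<^bsub>R\<^esub>"
    using pre unfolding field_preordering_def by blast+
  ultimately show ?thesis unfolding field_preordering_def by blast
qed

context field
begin

lemma preorderingD:
  assumes "field_preordering R P"
  shows "x \<in> P \<Longrightarrow> x \<in> carrier R" "a \<in> carrier R \<Longrightarrow> a \<otimes> a \<in> P"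
    "x \<in> P \<Longrightarrow> y \<in> P \<Longrightarrow> x \<oplus> y \<in> P" "x \<in> P \<Longrightarrow> y \<in> P \<Longrightarrow> x \<otimes> y \<in> P"
    "x \<in> P \<Longrightarrow> x \<oplus> \<one> = \<zero> \<Longrightarrow> False" "\<zero> \<in> P" "\<one> \<in> P"
proof -
  have "\<zero> \<otimes> \<zero> \<in> P" "\<one> \<otimes> \<one> \<in> P" using assms zero_closed one_closed unfolding field_preordering_def by blast+
  then show "\<zero> \<in> P" "\<one> \<in> P" by simp_all
qed (use assms in \<open>auto simp: field_preordering_def\<close>)

text \<open>If \<open>- a\<close> is not in \<open>P\<close>, then \<open>P + P a\<close> is still a
  preordering, and maximality puts \<open>a\<close> into \<open>P\<close>. The point is that
  \<open>-1\<close> stays outside: \<open>-1 = x + y a\<close> with \<open>x\<close>,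
  \<open>y\<close> in \<open>P\<close> would force \<open>y\<close> to be nonzero and
  \<open>- a\<close> to be \<open>(x + 1) / y\<close>, an element of \<open>P\<close>.\<close>

lemma maximal_preordering_total:
  assumes P: "field_preordering R P" and max: "\<And>Q. field_preordering R Q \<Longrightarrow> P \<subseteq> Q \<Longrightarrow> Q = P"
    and a: "a \<in> carrier R"
  shows "a \<in> P \<or> \<ominus> a \<in> P"
proof (rule disjCI)
  note D = preorderingD[OF P]
  assume na: "\<ominus> a \<notin> P"
  define Q where "Q = {x \<oplus> y \<otimes> a | x y. x \<in> P \<and> y \<in> P}"
  have QI: "x \<oplus> y \<otimes> a \<in> Q" if "x \<in> P" "y \<in> P" for x y using that by (auto simp: Q_def)
  have PQ: "P \<subseteq> Q"
  proof
    fix x assume x: "x \<in> P"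
    then show "x \<in> Q" using QI[OF x D(6)] D(1)[OF x] a by simp
  qed
  have aQ: "a \<in> Q" using QI[OF D(6,7)] a by simp
  have "field_preordering R Q"
    unfolding field_preordering_def
  proof (intro conjI ballI)
    show "Q \<subseteq> carrier R" using D(1) a by (auto simp: Q_def)
    show "b \<otimes> b \<in> Q" if "b \<in> carrier R" for b using D(2)[OF that] PQ by blast
    fix u assume u: "u \<in> Q"
    then obtain x y where x: "x \<in> P" "y \<in> P" and ueq: "u = x \<oplus> y \<otimes> a" by (auto simp: Q_def)
    note xc = D(1)[OF x(1)] D(1)[OF x(2)]
    {
      fix v assume v: "v \<in> Q"
      then obtain x' y' where x': "x' \<in> P" "y' \<in> P" and veq: "v = x' \<oplus> y' \<otimes> a" by (auto simp: Q_def)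
      note xc' = D(1)[OF x'(1)] D(1)[OF x'(2)]
      have "u \<oplus> v = (x \<oplus> x') \<oplus> (y \<oplus> y') \<otimes> a"
        unfolding ueq veq using a xc xc' by (simp add: l_distr a_ac)
      then show "u \<oplus> v \<in> Q" using QI D(3) x x' by simp
      have "u \<otimes> v = (x \<otimes> x' \<oplus> (y \<otimes> y') \<otimes> (a \<otimes> a)) \<oplus> (x \<otimes> y' \<oplus> y \<otimes> x') \<otimes> a"
        unfolding ueq veq using a xc xc' by (simp add: l_distr r_distr a_ac m_ac)
      moreover have "x \<otimes> x' \<oplus> (y \<otimes> y') \<otimes> (a \<otimes> a) \<in> P" "x \<otimes> y' \<oplus> y \<otimes> x' \<in> P"
        using x x' a by (simp_all add: D(2-4))
      ultimately show "u \<otimes> v \<in> Q" using QI by simp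
    }
    show "u \<oplus> \<one> \<noteq> \<zero>"
    proof
      assume "u \<oplus> \<one> = \<zero>"
      then have "(x \<oplus> \<one>) \<oplus> y \<otimes> a = \<zero>" using a xc by (simp add: ueq a_ac)
      then have "\<ominus> (y \<otimes> a) = x \<oplus> \<one>" by (rule minus_equality) (use a xc in simp_all)
      then have e: "y \<otimes> \<ominus> a = x \<oplus> \<one>" using a xc by (simp add: r_minus)
      have "y \<noteq> \<zero>"
      proof
        assume "y = \<zero>"
        with e a have "x \<oplus> \<one> = \<zero>" by simp
        with D(5) x show False by blast
      qed
      then have i: "inv y \<in> carrier R" "inv y \<otimes> y = \<one>"
        using xc field_Units Units_inv_closed Units_l_inv by auto
      \<comment> \<open>\<open>P\<close> is not known to be closed under inverses, so division by
        \<open>y\<close> is done as multiplication by \<open>y\<close> and by the square of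
        \<open>inv y\<close>.\<close>
      have "\<ominus> a = (inv y \<otimes> y) \<otimes> (inv y \<otimes> y) \<otimes> \<ominus> a" using a i by simp
      also have "\<dots> = (inv y \<otimes> inv y) \<otimes> (y \<otimes> (y \<otimes> \<ominus> a))" using a i(1) xc by (simp add: m_ac)
      also have "\<dots> \<in> P" unfolding e using i x by (simp add: D)
      finally show False using na by blast
    qed
  qed
  then have "Q = P" using max PQ by blast
  with aQ show "a \<in> P" by simp
qed

text \<open>For nonzero \<open>c\<close>, dividing the product of \<open>c\<close> and
  \<open>- c\<close> by the square of \<open>c\<close> would put \<open>-1\<close> into
  \<open>P\<close>.\<close>

lemma preordering_antisym:
  assumes P: "field_preordering R P" and c: "c \<in> P" "\<ominus> c \<in> P"
  shows "c = \<zero>"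
proof (rule ccontr)
  note D = preorderingD[OF P]
  assume nz: "c \<noteq> \<zero>"
  have cc: "c \<in> carrier R" using D(1) c by blast
  with nz have i: "inv c \<in> carrier R" "inv c \<otimes> c = \<one>"
    using field_Units Units_inv_closed Units_l_inv by auto
  have "(inv c \<otimes> inv c) \<otimes> (c \<otimes> \<ominus> c) = \<ominus> ((inv c \<otimes> c) \<otimes> (inv c \<otimes> c))"
    using cc i(1) by (simp add: r_minus m_ac)
  then have "(inv c \<otimes> inv c) \<otimes> (c \<otimes> \<ominus> c) = \<ominus> \<one>" using i by simp
  moreover have "(inv c \<otimes> inv c) \<otimes> (c \<otimes> \<ominus> c) \<in> P" using c i by (simp add: D)
  ultimately show False using D(5)[of "\<ominus> \<one>"] by (simp add: l_neg)
qed

lemma orderable_if_preordering: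
  assumes "field_preordering R T"
  shows "orderable R"
proof -
  have "\<exists>M\<in>{P. field_preordering R P \<and> T \<subseteq> P}. \<forall>X\<in>{P. field_preordering R P \<and> T \<subseteq> P}. M \<subseteq> X \<longrightarrow> X = M"
  proof (rule subset_Zorn_nonempty)
    show "{P. field_preordering R P \<and> T \<subseteq> P} \<noteq> {}" using assms by blast
    fix \<C> assume ne: "\<C> \<noteq> {}" and ch: "subset.chain {P. field_preordering R P \<and> T \<subseteq> P} \<C>"
    then have "subset.chain {P. field_preordering R P} \<C>" by (auto simp: subset_chain_def)
    then have "field_preordering R (\<Union>\<C>)" by (rule preordering_Union_chain[OF ne])
    moreover have "T \<subseteq> \<Union>\<C>" using ne ch unfolding subset_chain_def by blast
    ultimately show "\<Union>\<C> \<in> {P. field_preordering R P \<and> T \<subseteq> P}" by blast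
  qed
  then obtain P where mem: "P \<in> {P. field_preordering R P \<and> T \<subseteq> P}"
    and max: "\<forall>X\<in>{P. field_preordering R P \<and> T \<subseteq> P}. P \<subseteq> X \<longrightarrow> X = P"
    by (rule bexE)
  have P: "field_preordering R P" using mem by simp
  \<comment> \<open>A preordering above \<open>P\<close> also contains \<open>T\<close>, so
    \<open>P\<close> is maximal among all preorderings and not only among those above
    \<open>T\<close>.\<close>
  have "Q = P" if "field_preordering R Q" "P \<subseteq> Q" for Q
    using max that mem by (metis (mono_tags, lifting) mem_Collect_eq order_trans)
  note total = maximal_preordering_total[OF P this]
  note D = preorderingD[OF P]
  define le where "le = {(a, b). a \<in> carrier R \<and> b \<in> carrier R \<and> b \<ominus> a \<in> P}"
  have neg: "\<ominus> (b \<ominus> a) = a \<ominus> b" if "a \<in> carrier R" "b \<in> carrier R" for a b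
    using that by (simp add: minus_eq minus_add a_comm)
  have "refl_on (carrier R) le" by (auto simp: refl_on_def le_def minus_eq r_neg D(6))
  moreover have "trans le"
  proof (rule transI, unfold le_def, clarify)
    fix a b c assume car: "a \<in> carrier R" "b \<in> carrier R" "c \<in> carrier R" and "b \<ominus> a \<in> P" "c \<ominus> b \<in> P"
    then have "(c \<ominus> b) \<oplus> (b \<ominus> a) \<in> P" by (intro D)
    moreover have "(c \<ominus> b) \<oplus> (b \<ominus> a) = c \<ominus> a"
      using car by (simp add: minus_eq a_assoc r_neg1 r_neg2)
    ultimately show "c \<ominus> a \<in> P" by simp
  qed
  moreover have "antisym le"
  proof (rule antisymI, unfold le_def, clarify)
    fix a b assume car: "a \<in> carrier R" "b \<in> carrier R" and "b \<ominus> a \<in> P" "a \<ominus> b \<in> P"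
    then have "b \<ominus> a = \<zero>" using preordering_antisym[OF P, of "b \<ominus> a"] neg[OF car] by simp
    then show "a = b" using car by (simp add: r_right_minus_eq)
  qed
  moreover have "total_on (carrier R) le"
    unfolding total_on_def le_def
  proof (intro ballI impI)
    fix a b assume car: "a \<in> carrier R" "b \<in> carrier R"
    then have "b \<ominus> a \<in> P \<or> \<ominus> (b \<ominus> a) \<in> P" by (intro total minus_closed)
    then show "(a, b) \<in> {(a, b). a \<in> carrier R \<and> b \<in> carrier R \<and> b \<ominus> a \<in> P} \<or>
        (b, a) \<in> {(a, b). a \<in> carrier R \<and> b \<in> carrier R \<and> b \<ominus> a \<in> P}"
      using car neg by auto
  qed
  moreover have "le \<subseteq> carrier R \<times> carrier R" by (auto simp: le_def)
  ultimately have "linear_order_on (carrier R) le" by (simp add: order_on_defs)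
  moreover have "(a \<oplus> c, b \<oplus> c) \<in> le"
    if "a \<in> carrier R" "b \<in> carrier R" "c \<in> carrier R" "(a, b) \<in> le" for a b c
  proof -
    have "(b \<oplus> c) \<ominus> (a \<oplus> c) = (b \<oplus> \<ominus> a) \<oplus> (c \<oplus> \<ominus> c)"
      using that by (simp only: minus_eq minus_add a_ac a_closed a_inv_closed)
    then have "(b \<oplus> c) \<ominus> (a \<oplus> c) = b \<ominus> a"
      using that by (simp add: r_neg minus_eq)
    with that show ?thesis by (simp add: le_def)
  qed
  moreover have "(\<zero>, a \<otimes> b) \<in> le" if "(\<zero>, a) \<in> le" "(\<zero>, b) \<in> le" for a b
    using that D(4) by (auto simp: le_def minus_eq)
  ultimately show ?thesis unfolding orderable_def by (intro exI[of _ le]) simp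
qed

end

section \<open>Sums of norms in a commutative ring with involution\<close>

inductive_set norm_sums :: "('a, 'b) ring_scheme \<Rightarrow> ('a \<Rightarrow> 'a) \<Rightarrow> 'a set" for R s where
  zero: "\<zero>\<^bsub>R\<^esub> \<in> norm_sums R s"
| step: "x \<in> norm_sums R s \<Longrightarrow> r \<in> carrier R \<Longrightarrow> x \<oplus>\<^bsub>R\<^esub> r \<otimes>\<^bsub>R\<^esub> s r \<in> norm_sums R s"

text \<open>The form that sums the norms \<open>r s(r)\<close> of its coordinates has no nontrivial
  zero in any dimension. It is enough to speak of the last coordinate, since over a ring the
  summands can be permuted.\<close>

definition anisotropic :: "('a, 'b) ring_scheme \<Rightarrow> ('a \<Rightarrow> 'a) \<Rightarrow> bool" where
  "anisotropic R s \<longleftrightarrow> (\<forall>x\<in>norm_sums R s. \<forall>r\<in>carrier R. x \<oplus>\<^bsub>R\<^esub> r \<otimes>\<^bsub>R\<^esub> s r = \<zero>\<^bsub>R\<^esub> \<longrightarrow> r = \<zero>\<^bsub>R\<^esub>)"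

locale involutive_cring = cring R for R (structure) +
  fixes s assumes inv: "involution R s"
begin

lemmas s_simps = involutionD(2-6)[OF inv]

lemma s_zero: "s \<zero> = \<zero>"
  using ring_hom_zero[OF involutionD(1)[OF inv]] ring_axioms by blast

lemma s_minus: "x \<in> carrier R \<Longrightarrow> s (\<ominus> x) = \<ominus> s x"
proof -
  interpret ring_hom_ring R R s
    by (rule ring_hom_ringI2) (use ring_axioms involutionD(1)[OF inv] in auto)
  show "x \<in> carrier R \<Longrightarrow> s (\<ominus> x) = \<ominus> s x" by simp
qed

lemma norm_sums_carrier: "x \<in> norm_sums R s \<Longrightarrow> x \<in> carrier R"
  by (induction rule: norm_sums.induct) (simp_all add: s_simps)

lemma norm_sums_fixed: "x \<in> norm_sums R s \<Longrightarrow> s x = x"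
proof (induction rule: norm_sums.induct)
  case (step x r)
  then show ?case using norm_sums_carrier[OF step(1)] by (simp add: s_simps m_comm)
qed (rule s_zero)

lemma norm_sums_add: "y \<in> norm_sums R s \<Longrightarrow> x \<in> norm_sums R s \<Longrightarrow> x \<oplus> y \<in> norm_sums R s"
proof (induction rule: norm_sums.induct)
  case (step y r)
  then have "(x \<oplus> y) \<oplus> r \<otimes> s r \<in> norm_sums R s" by (intro norm_sums.step)
  then show ?case using norm_sums_carrier step by (simp add: s_simps a_assoc)
qed (simp add: norm_sums_carrier)

text \<open>Norms are multiplicative: by commutativity the norm of \<open>r\<close> times the norm
  of \<open>q\<close> is the norm of their product.\<close>

lemma norm_sums_mult_norm: "x \<in> norm_sums R s \<Longrightarrow> r \<in> carrier R \<Longrightarrow> (r \<otimes> s r) \<otimes> x \<in> norm_sums R s"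
proof (induction rule: norm_sums.induct)
  case (step x q)
  then have "(r \<otimes> s r) \<otimes> x \<oplus> (r \<otimes> q) \<otimes> s (r \<otimes> q) \<in> norm_sums R s" by (intro norm_sums.step) auto
  moreover have "(r \<otimes> q) \<otimes> s (r \<otimes> q) = (r \<otimes> s r) \<otimes> (q \<otimes> s q)"
    using step by (simp add: s_simps m_ac)
  ultimately show ?case using norm_sums_carrier step by (simp add: s_simps r_distr)
qed (simp add: s_simps norm_sums.zero)

lemma norm_sums_mult: "y \<in> norm_sums R s \<Longrightarrow> x \<in> norm_sums R s \<Longrightarrow> x \<otimes> y \<in> norm_sums R s"
proof (induction rule: norm_sums.induct)
  case (step y r)
  then have "x \<otimes> y \<oplus> (r \<otimes> s r) \<otimes> x \<in> norm_sums R s"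
    by (intro norm_sums_add norm_sums_mult_norm)
  then show ?case using norm_sums_carrier step by (simp add: s_simps r_distr m_comm)
qed (simp add: norm_sums_carrier norm_sums.zero)

end

locale involutive_field = field K + involutive_cring K s for K (structure) and s
begin

lemma subfield_fixed: "subfield {x \<in> carrier K. s x = x} K"
proof (rule subfieldI')
  show "subring {x \<in> carrier K. s x = x} K"
    by (rule subringI) (auto simp: s_simps s_minus)
  fix k assume "k \<in> {x \<in> carrier K. s x = x} - {\<zero>}"
  then have k: "k \<in> carrier K" "s k = k" "k \<noteq> \<zero>" by auto
  then have i: "inv k \<in> carrier K" "k \<otimes> inv k = \<one>"
    using field_Units Units_inv_closed Units_r_inv by auto
  have "s k \<otimes> s (inv k) = \<one>" using i k s_simps(4)[of k "inv k"] by (simp add: s_simps(5))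
  then have "k \<otimes> s (inv k) = k \<otimes> inv k" using i k by simp
  then have "s (inv k) = inv k" using m_lcancel[OF k(3,1), of "s (inv k)" "inv k"] i(1) by (simp add: s_simps)
  with i show "inv k \<in> {x \<in> carrier K. s x = x}" by simp
qed

text \<open>The square of a fixed element is its norm, so sums of norms contain all squares of the
  fixed field. Anisotropy with last coordinate \<open>1\<close> says that \<open>-1\<close> is not a
  sum of norms.\<close>

lemma orderable_fixed_field:
  assumes "anisotropic K s"
  shows "orderable (fixed_field K s)"
proof -
  let ?F = "fixed_field K s"
  interpret F: field ?F
    unfolding fixed_field_def by (rule subfield_iff(2)[OF subfield_fixed])
  have ops: "carrier ?F = {x \<in> carrier K. s x = x}" "x \<oplus>\<^bsub>?F\<^esub> y = x \<oplus> y" "x \<otimes>\<^bsub>?F\<^esub> y = x \<otimes> y"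
    "\<one>\<^bsub>?F\<^esub> = \<one>" "\<zero>\<^bsub>?F\<^esub> = \<zero>" for x y
    by (simp_all add: fixed_field_def)
  have "field_preordering ?F (norm_sums K s)"
    unfolding field_preordering_def ops
  proof (intro conjI ballI)
    show "norm_sums K s \<subseteq> {x \<in> carrier K. s x = x}" using norm_sums_carrier norm_sums_fixed by blast
    show "a \<otimes> a \<in> norm_sums K s" if "a \<in> {x \<in> carrier K. s x = x}" for a
      using norm_sums.step[OF norm_sums.zero, of a K s] that by simp
    show "x \<oplus> \<one> \<noteq> \<zero>" if "x \<in> norm_sums K s" for x
    proof
      assume "x \<oplus> \<one> = \<zero>"
      then have "x \<oplus> \<one> \<otimes> s \<one> = \<zero>" by (simp add: s_simps)
      then show False using assms that unfolding anisotropic_def by (metis one_closed one_not_zero)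
    qed
  qed (simp_all add: norm_sums_add norm_sums_mult)
  then show ?thesis by (rule F.orderable_if_preordering)
qed

text \<open>A multiple of \<open>1\<close> is a sum of norms of \<open>1\<close>, and a vanishing
  one would force the last coordinate \<open>1\<close> to be zero.\<close>

lemma characteristic_zero_if_anisotropic:
  assumes "anisotropic K s"
  shows "characteristic_zero K"
proof -
  have suc: "[Suc n] \<cdot> \<one> = [n] \<cdot> \<one> \<oplus> \<one> \<otimes> s \<one>" for n :: nat
    by (simp add: s_simps)
  have ns: "[n] \<cdot> \<one> \<in> norm_sums K s" for n :: nat
  proof (induction n)
    case (Suc n)
    show ?case unfolding suc using Suc by (rule norm_sums.step) simp
  qed (simp add: norm_sums.zero)
  have "[Suc n] \<cdot> \<one> \<noteq> \<zero>" for n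
    unfolding suc using assms ns[of n] unfolding anisotropic_def by (metis one_closed one_not_zero)
  then show ?thesis unfolding characteristic_zero_def using gr0_implies_Suc by blast
qed

end

section \<open>Anisotropy passes from a domain to its field of fractions\<close>

locale involutive_fractions = R: involutive_cring R \<sigma> + R: domain R + K: involutive_field K s
  for R (structure) and \<sigma> and K (structure) and s +
  fixes h
  assumes h_hom: "h \<in> ring_hom R K"
    and h_inj: "inj_on h (carrier R)"
    and h_involution: "a \<in> carrier R \<Longrightarrow> h (\<sigma> a) = s (h a)"
    and denominator: "x \<in> carrier K \<Longrightarrow> \<exists>a\<in>carrier R. \<exists>b\<in>carrier R - {\<zero>\<^bsub>R\<^esub>}. x \<otimes>\<^bsub>K\<^esub> h b = h a"
begin

sublocale h: ring_hom_cring R K h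
  by (rule ring_hom_cring.intro) (use h_hom in \<open>auto simp: ring_hom_cring_axioms_def R.is_cring K.is_cring\<close>)

lemma h_eq_zero_iff: "a \<in> carrier R \<Longrightarrow> h a = \<zero>\<^bsub>K\<^esub> \<longleftrightarrow> a = \<zero>\<^bsub>R\<^esub>"
  using inj_onD[OF h_inj, of a "\<zero>\<^bsub>R\<^esub>"] by auto

text \<open>Clearing denominators by norms keeps sums of norms sums of norms.\<close>

lemma norm_step_denominator:
  assumes t: "t \<in> carrier K" and x: "x \<in> carrier K" and d: "d \<in> carrier R" and y: "y \<in> carrier R"
    and dy: "h (d \<otimes>\<^bsub>R\<^esub> \<sigma> d) \<otimes>\<^bsub>K\<^esub> t = h y"
  obtains a b where "a \<in> carrier R" "b \<in> carrier R" "b \<noteq> \<zero>\<^bsub>R\<^esub>" "x \<otimes>\<^bsub>K\<^esub> h b = h a"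
    and "h ((b \<otimes>\<^bsub>R\<^esub> d) \<otimes>\<^bsub>R\<^esub> \<sigma> (b \<otimes>\<^bsub>R\<^esub> d)) \<otimes>\<^bsub>K\<^esub> (t \<oplus>\<^bsub>K\<^esub> x \<otimes>\<^bsub>K\<^esub> s x) =
      h ((b \<otimes>\<^bsub>R\<^esub> \<sigma> b) \<otimes>\<^bsub>R\<^esub> y \<oplus>\<^bsub>R\<^esub> (d \<otimes>\<^bsub>R\<^esub> a) \<otimes>\<^bsub>R\<^esub> \<sigma> (d \<otimes>\<^bsub>R\<^esub> a))"
proof -
  obtain a b where a: "a \<in> carrier R" and b: "b \<in> carrier R" "b \<noteq> \<zero>\<^bsub>R\<^esub>" and xb: "x \<otimes>\<^bsub>K\<^esub> h b = h a"
    using denominator[OF x] by blast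
  \<comment> \<open>The conjugate of \<open>x\<close> has the conjugate denominator, so the norm of
    \<open>b\<close> clears both factors of the norm of \<open>x\<close> at once.\<close>
  have "s (x \<otimes>\<^bsub>K\<^esub> h b) = s (h a)" using xb by simp
  then have sx: "s x \<otimes>\<^bsub>K\<^esub> h (\<sigma> b) = h (\<sigma> a)" using x a b by (simp add: K.s_simps h_involution)
  let ?n = "\<lambda>r. r \<otimes>\<^bsub>R\<^esub> \<sigma> r"
  have "h (?n (b \<otimes>\<^bsub>R\<^esub> d)) \<otimes>\<^bsub>K\<^esub> (t \<oplus>\<^bsub>K\<^esub> x \<otimes>\<^bsub>K\<^esub> s x)
    = h (?n b) \<otimes>\<^bsub>K\<^esub> (h (?n d) \<otimes>\<^bsub>K\<^esub> t) \<oplus>\<^bsub>K\<^esub> h (?n d) \<otimes>\<^bsub>K\<^esub> ((x \<otimes>\<^bsub>K\<^esub> h b) \<otimes>\<^bsub>K\<^esub> (s x \<otimes>\<^bsub>K\<^esub> h (\<sigma> b)))"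
    using x t b d by (simp add: R.s_simps K.s_simps K.r_distr K.m_ac)
  also have "\<dots> = h (?n b \<otimes>\<^bsub>R\<^esub> y \<oplus>\<^bsub>R\<^esub> ?n (d \<otimes>\<^bsub>R\<^esub> a))"
    unfolding dy xb sx using a b d y by (simp add: R.s_simps K.m_ac)
  finally show ?thesis using that a b xb by blast
qed

lemma norm_sums_denominator:
  "t \<in> norm_sums K s \<Longrightarrow> \<exists>d\<in>carrier R - {\<zero>\<^bsub>R\<^esub>}. \<exists>y\<in>norm_sums R \<sigma>. h (d \<otimes>\<^bsub>R\<^esub> \<sigma> d) \<otimes>\<^bsub>K\<^esub> t = h y"
proof (induction rule: norm_sums.induct)
  case zero
  show ?case
    by (rule bexI[of _ "\<one>\<^bsub>R\<^esub>"], rule bexI[of _ "\<zero>\<^bsub>R\<^esub>"]) (auto simp: R.s_simps norm_sums.zero)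
next
  case (step t x)
  from step(3) obtain d y where d: "d \<in> carrier R" "d \<noteq> \<zero>\<^bsub>R\<^esub>" and y: "y \<in> norm_sums R \<sigma>"
    and dy: "h (d \<otimes>\<^bsub>R\<^esub> \<sigma> d) \<otimes>\<^bsub>K\<^esub> t = h y" by blast
  obtain a b where a: "a \<in> carrier R" and b: "b \<in> carrier R" "b \<noteq> \<zero>\<^bsub>R\<^esub>"
    and eq: "h ((b \<otimes>\<^bsub>R\<^esub> d) \<otimes>\<^bsub>R\<^esub> \<sigma> (b \<otimes>\<^bsub>R\<^esub> d)) \<otimes>\<^bsub>K\<^esub> (t \<oplus>\<^bsub>K\<^esub> x \<otimes>\<^bsub>K\<^esub> s x) =
      h ((b \<otimes>\<^bsub>R\<^esub> \<sigma> b) \<otimes>\<^bsub>R\<^esub> y \<oplus>\<^bsub>R\<^esub> (d \<otimes>\<^bsub>R\<^esub> a) \<otimes>\<^bsub>R\<^esub> \<sigma> (d \<otimes>\<^bsub>R\<^esub> a))"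
    by (rule norm_step_denominator[OF K.norm_sums_carrier[OF step(1)] step(2) d(1) R.norm_sums_carrier[OF y] dy])
  have "(b \<otimes>\<^bsub>R\<^esub> \<sigma> b) \<otimes>\<^bsub>R\<^esub> y \<oplus>\<^bsub>R\<^esub> (d \<otimes>\<^bsub>R\<^esub> a) \<otimes>\<^bsub>R\<^esub> \<sigma> (d \<otimes>\<^bsub>R\<^esub> a) \<in> norm_sums R \<sigma>"
    using R.norm_sums_mult_norm[OF y b(1)] a d by (intro norm_sums.step) auto
  moreover have "b \<otimes>\<^bsub>R\<^esub> d \<in> carrier R - {\<zero>\<^bsub>R\<^esub>}" using b d R.mult_nonzero by simp
  ultimately show ?case using eq by blast
qed

text \<open>Multiplied by the norm of the common denominator \<open>b d\<close>, a vanishing sum of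
  norms in \<open>K\<close> becomes one in \<open>R\<close> whose last coordinate is
  \<open>d a\<close>. Hence \<open>d a = 0\<close>, and as \<open>d\<close> is nonzero the numerator
  \<open>a\<close> of \<open>x\<close> is zero.\<close>

lemma anisotropic_fractions:
  assumes "anisotropic R \<sigma>"
  shows "anisotropic K s"
  unfolding anisotropic_def
proof (intro ballI impI)
  fix t x assume t: "t \<in> norm_sums K s" and x: "x \<in> carrier K" and z: "t \<oplus>\<^bsub>K\<^esub> x \<otimes>\<^bsub>K\<^esub> s x = \<zero>\<^bsub>K\<^esub>"
  obtain d y where d: "d \<in> carrier R" "d \<noteq> \<zero>\<^bsub>R\<^esub>" and y: "y \<in> norm_sums R \<sigma>"
    and dy: "h (d \<otimes>\<^bsub>R\<^esub> \<sigma> d) \<otimes>\<^bsub>K\<^esub> t = h y" using norm_sums_denominator[OF t] by blast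
  note yc = R.norm_sums_carrier[OF y]
  obtain a b where a: "a \<in> carrier R" and b: "b \<in> carrier R" "b \<noteq> \<zero>\<^bsub>R\<^esub>" and xb: "x \<otimes>\<^bsub>K\<^esub> h b = h a"
    and eq: "h ((b \<otimes>\<^bsub>R\<^esub> d) \<otimes>\<^bsub>R\<^esub> \<sigma> (b \<otimes>\<^bsub>R\<^esub> d)) \<otimes>\<^bsub>K\<^esub> (t \<oplus>\<^bsub>K\<^esub> x \<otimes>\<^bsub>K\<^esub> s x) =
      h ((b \<otimes>\<^bsub>R\<^esub> \<sigma> b) \<otimes>\<^bsub>R\<^esub> y \<oplus>\<^bsub>R\<^esub> (d \<otimes>\<^bsub>R\<^esub> a) \<otimes>\<^bsub>R\<^esub> \<sigma> (d \<otimes>\<^bsub>R\<^esub> a))"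
    by (rule norm_step_denominator[OF K.norm_sums_carrier[OF t] x d(1) yc dy])
  let ?w = "(b \<otimes>\<^bsub>R\<^esub> \<sigma> b) \<otimes>\<^bsub>R\<^esub> y \<oplus>\<^bsub>R\<^esub> (d \<otimes>\<^bsub>R\<^esub> a) \<otimes>\<^bsub>R\<^esub> \<sigma> (d \<otimes>\<^bsub>R\<^esub> a)"
  have "h ?w = \<zero>\<^bsub>K\<^esub>"
    unfolding eq[symmetric] z using b d by (intro K.r_null h.hom_closed) (simp add: R.s_simps)
  moreover have "?w \<in> carrier R" using a b d yc by (simp add: R.s_simps)
  ultimately have "?w = \<zero>\<^bsub>R\<^esub>" using h_eq_zero_iff by blast
  then have "d \<otimes>\<^bsub>R\<^esub> a = \<zero>\<^bsub>R\<^esub>"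
    using assms R.norm_sums_mult_norm[OF y b(1)] R.m_closed[OF d(1) a] unfolding anisotropic_def by blast
  then have "a = \<zero>\<^bsub>R\<^esub>" using R.mult_nonzero d a by blast
  then have "x \<otimes>\<^bsub>K\<^esub> h b = \<zero>\<^bsub>K\<^esub>" using xb by simp
  then show "x = \<zero>\<^bsub>K\<^esub>" using K.mult_nonzero[OF x h.hom_closed[OF b(1)]] h_eq_zero_iff[OF b(1)] b(2) by blast
qed

text \<open>The locale describes the field by denominators and not by its construction, so a copy in
  another type satisfies it as well and inherits \<open>anisotropic_fractions\<close>. This moves
  \<open>fraction_field\<close>, whose elements are nested sets of pairs, to sets of quadruples of
  scalars.\<close>

lemma transport_fractions:
  assumes \<phi>: "inj_on \<phi> (carrier K)"
  obtains s' where "involutive_fractions R \<sigma> (image_ring \<phi> K) s' (\<phi> \<circ> h)"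
proof -
  let ?K = "image_ring \<phi> K"
  let ?i = "inv_into (carrier K) \<phi>"
  define s' where "s' = \<phi> \<circ> s \<circ> ?i"
  have \<phi>_hom: "\<phi> \<in> ring_hom K ?K"
    using inj_imp_image_ring_iso[OF \<phi>] by (simp add: ring_iso_def)
  have car: "carrier ?K = \<phi> ` carrier K" by (rule image_ring_carrier)
  have i: "?i (\<phi> x) = x" if "x \<in> carrier K" for x using \<phi> that by simp
  have s': "s' (\<phi> x) = \<phi> (s x)" if "x \<in> carrier K" for x using that by (simp add: s'_def i)
  have ops: "\<phi> x \<oplus>\<^bsub>?K\<^esub> \<phi> y = \<phi> (x \<oplus>\<^bsub>K\<^esub> y)" "\<phi> x \<otimes>\<^bsub>?K\<^esub> \<phi> y = \<phi> (x \<otimes>\<^bsub>K\<^esub> y)"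
    if "x \<in> carrier K" "y \<in> carrier K" for x y
    using ring_hom_add[OF \<phi>_hom that] ring_hom_mult[OF \<phi>_hom that] by simp_all
  interpret K': field ?K by (rule K.inj_imp_image_ring_is_field[OF \<phi>])
  have "involution ?K s'"
  proof (rule involutionI)
    show "s' \<in> ring_hom ?K ?K"
    proof (rule ring_hom_memI)
      show "s' \<one>\<^bsub>?K\<^esub> = \<one>\<^bsub>?K\<^esub>"
        using s'[of "\<one>\<^bsub>K\<^esub>"] ring_hom_one[OF \<phi>_hom] by (simp add: K.s_simps)
    qed (auto simp: car s' ops K.s_simps)
    show "s' (s' x) = x" if "x \<in> carrier ?K" for x using that by (auto simp: car s' K.s_simps)
  qed
  then have "involutive_fractions R \<sigma> ?K s' (\<phi> \<circ> h)"
  proof unfold_locales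
    show "\<phi> \<circ> h \<in> ring_hom R ?K" using ring_hom_trans[OF h_hom \<phi>_hom] .
    show "inj_on (\<phi> \<circ> h) (carrier R)"
      using h_inj \<phi> by (intro comp_inj_on) (auto intro: inj_on_subset)
    show "(\<phi> \<circ> h) (\<sigma> a) = s' ((\<phi> \<circ> h) a)" if "a \<in> carrier R" for a
      using that by (simp add: s' h_involution)
    fix x assume "x \<in> carrier ?K"
    then obtain y where y: "y \<in> carrier K" "x = \<phi> y" by (auto simp: car)
    obtain a b where ab: "a \<in> carrier R" "b \<in> carrier R - {\<zero>\<^bsub>R\<^esub>}" "y \<otimes>\<^bsub>K\<^esub> h b = h a"
      using denominator[OF y(1)] by blast
    then have "x \<otimes>\<^bsub>?K\<^esub> (\<phi> \<circ> h) b = (\<phi> \<circ> h) a" using y by (simp add: ops)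
    with ab show "\<exists>a\<in>carrier R. \<exists>b\<in>carrier R - {\<zero>\<^bsub>R\<^esub>}. x \<otimes>\<^bsub>?K\<^esub> (\<phi> \<circ> h) b = (\<phi> \<circ> h) a" by blast
  qed
  with that show ?thesis by blast
qed

end

text \<open>The pair \<open>(u, v)\<close> stands for the difference \<open>u - v\<close>.\<close>

inductive_set norm_sum_pairs :: "('a, 'b) ring_scheme \<Rightarrow> ('a \<Rightarrow> 'a) \<Rightarrow> ('a \<times> 'a) set" for R \<sigma> where
  zero: "(\<zero>\<^bsub>R\<^esub>, \<zero>\<^bsub>R\<^esub>) \<in> norm_sum_pairs R \<sigma>"
| step: "\<lbrakk>(u, v) \<in> norm_sum_pairs R \<sigma>; a \<in> carrier R; b \<in> carrier R\<rbrakk> \<Longrightarrow>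
    (u \<oplus>\<^bsub>R\<^esub> (a \<otimes>\<^bsub>R\<^esub> \<sigma> a \<oplus>\<^bsub>R\<^esub> b \<otimes>\<^bsub>R\<^esub> \<sigma> b), v \<oplus>\<^bsub>R\<^esub> (a \<otimes>\<^bsub>R\<^esub> \<sigma> b \<oplus>\<^bsub>R\<^esub> b \<otimes>\<^bsub>R\<^esub> \<sigma> a))
      \<in> norm_sum_pairs R \<sigma>"

section \<open>From conditions on differences in a semiring to the orderable field\<close>

locale embeddable_semiring = cancel_comm_semiring R for R (structure) +
  fixes \<sigma>
  assumes inv: "involution R \<sigma>"
    and one_neq_zero: "\<one> \<noteq> \<zero>"
    and difference_integral: "\<lbrakk>a \<in> carrier R; b \<in> carrier R; c \<in> carrier R; d \<in> carrier R;
      a \<otimes> c \<oplus> b \<otimes> d = a \<otimes> d \<oplus> b \<otimes> c\<rbrakk> \<Longrightarrow> a = b \<or> c = d"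
    and difference_anisotropic: "\<lbrakk>(u, v) \<in> norm_sum_pairs R \<sigma>; a \<in> carrier R; b \<in> carrier R;
      u \<oplus> (a \<otimes> \<sigma> a \<oplus> b \<otimes> \<sigma> b) = v \<oplus> (a \<otimes> \<sigma> b \<oplus> b \<otimes> \<sigma> a)\<rbrakk> \<Longrightarrow> a = b"
begin

lemma norm_sum_pairs_carrier: "(u, v) \<in> norm_sum_pairs R \<sigma> \<Longrightarrow> u \<in> carrier R \<and> v \<in> carrier R"
  by (induction rule: norm_sum_pairs.induct) (simp_all add: involutionD[OF inv])

lemma domain_difference_ring: "domain difference_ring"
proof -
  interpret D: cring difference_ring by (rule cring_difference_ring)
  show ?thesis
  proof
    show "\<one>\<^bsub>difference_ring\<^esub> \<noteq> \<zero>\<^bsub>difference_ring\<^esub>"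
      using one_neq_zero by (simp add: difference_one_zero difference_eq_iff)
    fix x y assume xy: "x \<otimes>\<^bsub>difference_ring\<^esub> y = \<zero>\<^bsub>difference_ring\<^esub>"
      and x: "x \<in> carrier difference_ring" and y: "y \<in> carrier difference_ring"
    obtain a b where ab: "a \<in> carrier R" "b \<in> carrier R" "x = difference a b" using x by (rule difference_cases)
    obtain c d where cd: "c \<in> carrier R" "d \<in> carrier R" "y = difference c d" using y by (rule difference_cases)
    have "a \<otimes> c \<oplus> b \<otimes> d = a \<otimes> d \<oplus> b \<otimes> c"
      using xy ab cd by (simp add: difference_one_zero difference_eq_iff)
    then have "a = b \<or> c = d" using difference_integral ab cd by blast
    then show "x = \<zero>\<^bsub>difference_ring\<^esub> \<or> y = \<zero>\<^bsub>difference_ring\<^esub>"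
      using ab cd by (auto simp: difference_one_zero difference_eq_iff)
  qed
qed

lemma anisotropic_difference_ring:
  assumes s: "\<forall>a\<in>carrier R. \<forall>b\<in>carrier R. s (difference a b) = difference (\<sigma> a) (\<sigma> b)"
  shows "anisotropic difference_ring s"
proof -
  note \<sigma> = involutionD[OF inv]
  have norm: "difference a b \<otimes>\<^bsub>difference_ring\<^esub> s (difference a b)
      = difference (a \<otimes> \<sigma> a \<oplus> b \<otimes> \<sigma> b) (a \<otimes> \<sigma> b \<oplus> b \<otimes> \<sigma> a)" if "a \<in> carrier R" "b \<in> carrier R" for a b
    using that by (simp add: s \<sigma>)
  have pair: "\<exists>u v. (u, v) \<in> norm_sum_pairs R \<sigma> \<and> x = difference u v" if "x \<in> norm_sums difference_ring s" for x
    using that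
  proof (induction rule: norm_sums.induct)
    case zero
    show ?case using norm_sum_pairs.zero difference_one_zero(2) by blast
  next
    case (step x r)
    then obtain u v where uv: "(u, v) \<in> norm_sum_pairs R \<sigma>" "x = difference u v" by blast
    obtain a b where ab: "a \<in> carrier R" "b \<in> carrier R" "r = difference a b"
      using step(2) by (rule difference_cases)
    have "x \<oplus>\<^bsub>difference_ring\<^esub> r \<otimes>\<^bsub>difference_ring\<^esub> s r = difference
      (u \<oplus> (a \<otimes> \<sigma> a \<oplus> b \<otimes> \<sigma> b)) (v \<oplus> (a \<otimes> \<sigma> b \<oplus> b \<otimes> \<sigma> a))"
      unfolding uv ab norm[OF ab(1,2)] using norm_sum_pairs_carrier[OF uv(1)] ab by (simp add: \<sigma>)
    then show ?case using norm_sum_pairs.step[OF uv(1) ab(1,2)] by blast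
  qed
  show ?thesis
    unfolding anisotropic_def
  proof (intro ballI impI)
    fix x r assume "x \<in> norm_sums difference_ring s" and r: "r \<in> carrier difference_ring"
      and z: "x \<oplus>\<^bsub>difference_ring\<^esub> r \<otimes>\<^bsub>difference_ring\<^esub> s r = \<zero>\<^bsub>difference_ring\<^esub>"
    then obtain u v where uv: "(u, v) \<in> norm_sum_pairs R \<sigma>" "x = difference u v" using pair by blast
    obtain a b where ab: "a \<in> carrier R" "b \<in> carrier R" "r = difference a b" using r by (rule difference_cases)
    have "u \<oplus> (a \<otimes> \<sigma> a \<oplus> b \<otimes> \<sigma> b) = v \<oplus> (a \<otimes> \<sigma> b \<oplus> b \<otimes> \<sigma> a)"
      using z norm_sum_pairs_carrier[OF uv(1)] ab(1,2) unfolding uv ab norm[OF ab(1,2)]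
      by (simp add: difference_one_zero difference_eq_iff \<sigma>)
    then have "a = b" using difference_anisotropic uv ab by blast
    then show "r = \<zero>\<^bsub>difference_ring\<^esub>" using ab by (simp add: difference_one_zero difference_eq_iff a_comm)
  qed
qed

theorem embeds_in_orderable_field:
  "\<exists>(K :: ('a \<times> 'a \<times> 'a \<times> 'a) set ring) s h.
    field K \<and> involution K s \<and> characteristic_zero K \<and> orderable (fixed_field K s) \<and>
    semiring_embedding R K h \<and> (\<forall>a\<in>carrier R. h (\<sigma> a) = s (h a))"
proof -
  let ?D = difference_ring
  interpret D: domain ?D by (rule domain_difference_ring)
  obtain s1 where s1: "involution ?D s1"
    and s1_eq: "\<forall>a\<in>carrier R. \<forall>b\<in>carrier R. s1 (difference a b) = difference (\<sigma> a) (\<sigma> b)"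
    by (rule difference_involution[OF inv])
  obtain s2 where s2: "involution D.fraction_field s2"
    and s2_eq: "\<forall>a\<in>carrier ?D. s2 (D.fraction a \<one>\<^bsub>?D\<^esub>) = D.fraction (s1 a) \<one>\<^bsub>?D\<^esub>"
    by (rule D.fraction_involution[OF s1])
  let ?F = D.fraction_field and ?f = "\<lambda>a. D.fraction a \<one>\<^bsub>?D\<^esub>"
  interpret F: field ?F by (rule D.field_fraction_field)
  have "involutive_fractions ?D s1 ?F s2 ?f"
  proof unfold_locales
    show "\<exists>a\<in>carrier ?D. \<exists>b\<in>carrier ?D - {\<zero>\<^bsub>?D\<^esub>}. x \<otimes>\<^bsub>?F\<^esub> ?f b = ?f a" if x: "x \<in> carrier ?F" for x
    proof -
      obtain a b where "a \<in> carrier ?D" "b \<in> carrier ?D - {\<zero>\<^bsub>?D\<^esub>}" "x \<otimes>\<^bsub>?F\<^esub> ?f b = ?f a"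
        by (rule D.fraction_mult_denominator[OF x])
      then show ?thesis by (intro bexI)
    qed
  qed (use s1 s2 s2_eq D.fraction_embed in auto)
  then interpret DF: involutive_fractions ?D s1 ?F s2 ?f .
  \<comment> \<open>A fraction is coded by all its representations \<open>(a - b) / (c - d)\<close>.\<close>
  define \<phi> where "\<phi> x = {(a, b, c, d). a \<in> carrier R \<and> b \<in> carrier R \<and> c \<in> carrier R \<and> d \<in> carrier R \<and>
    c \<noteq> d \<and> x \<otimes>\<^bsub>?F\<^esub> ?f (difference c d) = ?f (difference a b)}" for x
  have "inj_on \<phi> (carrier ?F)"
  proof (rule inj_onI)
    fix x y assume x: "x \<in> carrier ?F" and y: "y \<in> carrier ?F" and eq: "\<phi> x = \<phi> y"
    obtain p q where p: "p \<in> carrier ?D" and q: "q \<in> carrier ?D" "q \<noteq> \<zero>\<^bsub>?D\<^esub>" and xq: "x \<otimes>\<^bsub>?F\<^esub> ?f q = ?f p"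
      using DF.denominator[OF x] by blast
    obtain a b where ab: "a \<in> carrier R" "b \<in> carrier R" "p = difference a b" using p by (rule difference_cases)
    obtain c d where cd: "c \<in> carrier R" "d \<in> carrier R" "q = difference c d" using q(1) by (rule difference_cases)
    have "c \<noteq> d" using q cd by (auto simp: difference_one_zero difference_eq_iff a_comm)
    \<comment> \<open>One common representation is enough: \<open>x\<close> and \<open>y\<close>
      both become \<open>?f p\<close> when multiplied by \<open>?f q\<close>, which is
      nonzero.\<close>
    then have "(a, b, c, d) \<in> \<phi> x" using xq ab cd by (simp add: \<phi>_def)
    then have yq: "y \<otimes>\<^bsub>?F\<^esub> ?f q = ?f p" unfolding eq using ab cd by (simp add: \<phi>_def)
    have "?f q \<noteq> \<zero>\<^bsub>?F\<^esub>" using DF.h_eq_zero_iff q by blast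
    then show "x = y" using F.m_rcancel[of "?f q" x y] x y q DF.h.hom_closed[of q] xq yq by simp
  qed
  then obtain s where "involutive_fractions ?D s1 (image_ring \<phi> ?F) s (\<phi> \<circ> ?f)"
    by (rule DF.transport_fractions)
  then interpret K: involutive_fractions ?D s1 "image_ring \<phi> ?F" s "\<phi> \<circ> ?f" .
  let ?K = "image_ring \<phi> ?F" and ?h = "\<lambda>a. (\<phi> \<circ> ?f) (difference a \<zero>)"
  have aniso: "anisotropic ?K s"
    by (rule K.anisotropic_fractions[OF anisotropic_difference_ring[OF s1_eq]])
  have hom: "?h \<in> ring_hom R ?K"
    using ring_hom_trans[OF difference_embed(1) K.h_hom] by (simp add: comp_def)
  moreover have "inj_on ?h (carrier R)"
  proof (rule inj_onI)
    fix a b assume ab: "a \<in> carrier R" "b \<in> carrier R" "?h a = ?h b"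
    then have "difference a \<zero> = difference b \<zero>" by (intro inj_onD[OF K.h_inj]) simp_all
    then show "a = b" using inj_onD[OF difference_embed(2)] ab(1,2) by blast
  qed
  moreover have "?h \<zero> = \<zero>\<^bsub>?K\<^esub>"
    using K.h.hom_zero by (simp add: difference_one_zero)
  ultimately have emb: "semiring_embedding R ?K ?h" by (simp add: semiring_embedding_def)
  have s0: "\<sigma> \<zero> = \<zero>"
  proof (rule a_cancel)
    show "\<sigma> \<zero> \<oplus> \<sigma> \<zero> = \<sigma> \<zero> \<oplus> \<zero>" using involutionD(4)[OF inv, of \<zero> \<zero>] by (simp add: involutionD(2)[OF inv])
  qed (simp_all add: involutionD(2)[OF inv])
  have "?h (\<sigma> a) = s (?h a)" if "a \<in> carrier R" for a
    using K.h_involution[of "difference a \<zero>"] s1_eq that by (simp add: s0)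
  then have compat: "\<forall>a\<in>carrier R. ?h (\<sigma> a) = s (?h a)" by blast
  show ?thesis
    using K.K.field_axioms K.K.inv K.K.characteristic_zero_if_anisotropic[OF aniso]
      K.K.orderable_fixed_field[OF aniso] emb compat
    by (intro exI[of _ ?K] exI[of _ s] exI[of _ ?h] conjI)
qed

end

section \<open>Dagger limits\<close>

text \<open>One family covers both shapes that occur: no arc gives binary products, two arcs give
  equalisers. Vertices and arcs are numbers because \<open>has_finite_dagger_limits\<close> speaks
  of such graphs.\<close>

definition arrow_graph :: "nat set \<Rightarrow> (nat, nat) pre_digraph" where
  "arrow_graph K = \<lparr>verts = {0, 1}, arcs = K, tail = \<lambda>_. 0, head = \<lambda>_. 1\<rparr>"

lemma arrow_graph_simps [simp]:
  "verts (arrow_graph K) = {0, 1}" "arcs (arrow_graph K) = K"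
  "tail (arrow_graph K) e = 0" "head (arrow_graph K) e = 1"
  by (simp_all add: arrow_graph_def)

lemma fin_digraph_arrow_graph: "finite K \<Longrightarrow> fin_digraph (arrow_graph K)"
  by unfold_locales auto

lemma awalk_arrow_graph:
  "pre_digraph.awalk (arrow_graph K) u p v \<longleftrightarrow>
    (p = [] \<and> u = v \<and> v \<in> {0, 1}) \<or> (u = 0 \<and> v = 1 \<and> (\<exists>k\<in>K. p = [k]))"
proof (cases p)
  case Nil
  then show ?thesis by (auto simp: pre_digraph.awalk_def pre_digraph.cas.simps)
next
  case (Cons k q)
  then show ?thesis
    by (cases q) (auto simp: pre_digraph.awalk_def pre_digraph.cas.simps)
qed

lemma vwalk_single_arrow:
  assumes "arcs_ends H \<subseteq> {(0, 1 :: nat)}" and "vwalk p H"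
  shows "(\<exists>x\<in>verts H. p = [x]) \<or> (p = [0, 1] \<and> (0, 1) \<in> arcs_ends H)"
proof (cases p rule: vwalk_arcs.cases)
  case (3 x y xs)
  with assms have "xs = []"
    by (cases xs) (auto simp: vwalk_def)
  with 3 assms show ?thesis by (auto simp: vwalk_def)
qed (use assms in \<open>auto simp: vwalk_def\<close>)

text \<open>A connected induced subgraph is a single vertex, its own root, or has both vertices and
  therefore an arc, with root \<open>1\<close>. Parallel arcs do not spoil uniqueness, since they
  give the same sequence of vertices.\<close>

lemma rooted_in_tree_arrow_graph:
  assumes H: "induced_subgraph H (arrow_graph K)" and conn: "Digraph_Component.connected H"
  shows "rooted_in_tree H"
proof -
  let ?G = "arrow_graph K"
  have sub: "subgraph H ?G" and arcs: "arcs H = {e \<in> K. 0 \<in> verts H \<and> 1 \<in> verts H}"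
    using H by (auto simp: induced_subgraph_def)
  have V: "verts H \<subseteq> {0, 1}" and compat: "tail H = (\<lambda>_. 0)" "head H = (\<lambda>_. 1)"
    using sub by (auto simp: subgraph_def compatible_def fun_eq_iff)
  have ends: "arcs_ends H = (if arcs H = {} then {} else {(0, 1)})"
    by (auto simp: arcs_ends_def arc_to_ends_def compat)
  have ne: "verts H \<noteq> {}"
    using conn by (auto simp: Digraph_Component.connected_def strongly_connected_def)
  have walks: "vwalk p H \<Longrightarrow> (\<exists>x\<in>verts H. p = [x]) \<or> (p = [0, 1] \<and> (0, 1) \<in> arcs_ends H)" for p
    using vwalk_single_arrow[of H p] ends by auto
  consider v where "verts H = {v}" | "verts H = {0, 1}"
    using V ne by auto
  then show ?thesis
  proof cases
    case 1
    then have "arcs H = {}" using arcs by auto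
    with ends have "arcs_ends H = {}" by simp
    then have "vwalk p H \<longleftrightarrow> p = [v]" for p
      using walks[of p] 1 by (auto simp: vwalk_def)
    then have "\<exists>!p. vwalk p H \<and> hd p = v \<and> last p = v"
      by (intro ex1I[of _ "[v]"]) simp_all
    with 1 show ?thesis unfolding rooted_in_tree_def by simp
  next
    case 2
    have "arcs H \<noteq> {}"
    proof
      assume "arcs H = {}"
      then have "parcs (mk_symmetric H) = {}" by (simp add: mk_symmetric_def)
      moreover have "0 \<rightarrow>\<^sup>*\<^bsub>mk_symmetric H\<^esub> 1"
        using conn 2 by (auto simp: Digraph_Component.connected_def strongly_connected_def)
      ultimately have "(0 :: nat, 1) \<in> rtrancl_on (verts H) {}"
        by (simp add: reachable_def)
      then show False by (rule rtrancl_on.cases) auto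
    qed
    with ends have ends: "arcs_ends H = {(0, 1)}" by simp
    have w: "vwalk p H \<longleftrightarrow> p = [0] \<or> p = [1] \<or> p = [0, 1]" for p
    proof
      show "vwalk p H \<Longrightarrow> p = [0] \<or> p = [1] \<or> p = [0, 1]"
        using walks[of p] 2 by auto
      show "p = [0] \<or> p = [1] \<or> p = [0, 1] \<Longrightarrow> vwalk p H"
        using 2 ends by (elim disjE) (simp_all add: vwalk_def)
    qed
    have "\<exists>!p. vwalk p H \<and> hd p = v \<and> last p = 1" if "v \<in> verts H" for v
    proof (rule ex1I)
      show "vwalk (if v = 0 then [0, 1] else [1]) H \<and> hd (if v = 0 then [0, 1] else [1]) = v
          \<and> last (if v = 0 then [0, 1] else [1]) = (1::nat)"
        using that 2 by (auto simp: w)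
    qed (auto simp: w)
    with 2 show ?thesis unfolding rooted_in_tree_def by blast
  qed
qed

lemma finite_forest_multigraph_arrow_graph: "finite K \<Longrightarrow> finite_forest_multigraph (arrow_graph K)"
  by (auto simp: finite_forest_multigraph_def weak_components_def fin_digraph_arrow_graph
      intro: rooted_in_tree_arrow_graph)

text \<open>Vertex \<open>1\<close> is a target as soon as there is an arc. Hence the normalisation
  of an equaliser has a single summand and makes its arrow an isometry, whereas a product gets a
  summand for each projection.\<close>

lemma leaves_arrow_graph:
  "leaves (free_category (arrow_graph K)) = (if K = {} then {0, 1} else {0})"
  by (auto simp: leaves_def free_category_def awalk_arrow_graph)

text \<open>A nonempty walk is a single arc, so its image can be read off from \<open>hd p\<close>
  and no composite of arcs arises.\<close>

lemma (in category) cat_functor_arrow_graph: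
  assumes "A 0 \<in> objs C" "A 1 \<in> objs C" and "\<And>k. k \<in> K \<Longrightarrow> f k \<in> homset C (A 0) (A 1)"
  shows "cat_functor (free_category (arrow_graph K)) C A
    (\<lambda>(u, p, v). if p = [] then idn C (A u) else f (hd p))"
proof -
  interpret J: category "free_category (arrow_graph K)"
  proof (rule category_free_category)
    show "wf_digraph (arrow_graph K)" by unfold_locales auto
  qed
  have idn: "X \<in> objs C \<Longrightarrow> idn C X \<in> arrs C \<and> src C (idn C X) = X \<and> trg C (idn C X) = X" for X
    using idn_in_homset by (auto simp: homset_def)
  have Fa: "(case a of (u, p, v) \<Rightarrow> if p = [] then idn C (A u) else f (hd p)) \<in> homset C (A S) (A T)"
    if "a \<in> homset (free_category (arrow_graph K)) S T" for a S T
    using that assms by (auto simp: free_category_def homset_def awalk_arrow_graph idn)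
  show ?thesis
  proof unfold_locales
    fix a b R S T
    assume "a \<in> homset (free_category (arrow_graph K)) R S" "b \<in> homset (free_category (arrow_graph K)) S T"
    note ab = this
    obtain p q where p: "a = (R, p, S)" "b = (S, q, T)"
      using ab by (auto simp: free_category_def homset_def)
    then have w: "pre_digraph.awalk (arrow_graph K) R p S" "pre_digraph.awalk (arrow_graph K) S q T"
      using ab by (auto simp: free_category_def homset_def)
    show "(case a \<Zsemi>\<^bsub>free_category (arrow_graph K)\<^esub> b of (u, p, v) \<Rightarrow> if p = [] then idn C (A u) else f (hd p)) =
      (case a of (u, p, v) \<Rightarrow> if p = [] then idn C (A u) else f (hd p)) \<Zsemi>
      (case b of (u, p, v) \<Rightarrow> if p = [] then idn C (A u) else f (hd p))"
    proof (cases "p = []")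
      case True
      then show ?thesis using idn_seqc[OF Fa[OF ab(2)]] w p
        by (auto simp: free_category_def awalk_arrow_graph)
    next
      case False
      \<comment> \<open>A nonempty \<open>p\<close> ends in vertex \<open>1\<close>, where only the
        empty walk starts.\<close>
      then have "q = []" using w by (auto simp: awalk_arrow_graph)
      then show ?thesis using seqc_idn[OF Fa[OF ab(1)]] w p
        by (auto simp: free_category_def awalk_arrow_graph)
    qed
  qed (use assms Fa in \<open>auto simp: free_category_def\<close>)
qed

section \<open>Calculus of arrows, sums and daggers\<close>

locale dagger_limit_category = dagger_category C + cmon_enriched_category C
  for C :: "('o, 'm, 'z) enriched_dagger_category_scheme" (structure) +
  assumes finite_dagger_limits: "has_finite_dagger_limits C"
begin

lemma homsetI: "f \<in> arrs C \<Longrightarrow> src C f = A \<Longrightarrow> trg C f = B \<Longrightarrow> f \<in> homset C A B"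
  by (simp add: homset_def)

lemma homsetD:
  assumes "f \<in> homset C A B"
  shows "f \<in> arrs C" "src C f = A" "trg C f = B" "A \<in> objs C" "B \<in> objs C"
  using assms src_in_objs trg_in_objs by (auto simp: homset_def)

declare src_in_objs [simp] trg_in_objs [simp]

lemma idn_arrs [simp]:
  assumes "A \<in> objs C"
  shows "idn C A \<in> arrs C" "src C (idn C A) = A" "trg C (idn C A) = A"
  using homsetD[OF idn_in_homset[OF assms]] by simp_all

lemma seqc_arrs [simp]:
  assumes "f \<in> arrs C" "g \<in> arrs C" "trg C f = src C g"
  shows "f \<Zsemi> g \<in> arrs C" "src C (f \<Zsemi> g) = src C f" "trg C (f \<Zsemi> g) = trg C g"
  using homsetD[OF seqc_in_homset[OF homsetI[OF assms(1) refl assms(3)] homsetI[OF assms(2) refl refl]]]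
  by simp_all

lemma idn_seqc_arr [simp]: "f \<in> arrs C \<Longrightarrow> src C f = A \<Longrightarrow> idn C A \<Zsemi> f = f"
  by (rule idn_seqc) (simp add: homset_def)

lemma seqc_idn_arr [simp]: "f \<in> arrs C \<Longrightarrow> trg C f = A \<Longrightarrow> f \<Zsemi> idn C A = f"
  by (rule seqc_idn) (simp add: homset_def)

lemma seqc_assoc_arr [simp]:
  assumes "f \<in> arrs C" "g \<in> arrs C" "h \<in> arrs C" "trg C f = src C g" "trg C g = src C h"
  shows "(f \<Zsemi> g) \<Zsemi> h = f \<Zsemi> (g \<Zsemi> h)"
  using assms by (intro seqc_assoc) (auto simp: homset_def)

text \<open>Composites are normalised by nesting to the right, where \<open>f\<close> and
  \<open>g\<close> are no longer adjacent once something follows them. This form lets the equation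
  rewrite such a nested composite too.\<close>

lemma reassoc:
  assumes "f \<Zsemi> g = k" "f \<in> arrs C" "g \<in> arrs C" "trg C f = src C g"
    and "h \<in> arrs C" "trg C g = src C h"
  shows "f \<Zsemi> (g \<Zsemi> h) = k \<Zsemi> h"
  using seqc_assoc_arr[of f g h] assms by simp

lemma dag_arrs [simp]:
  assumes "f \<in> arrs C"
  shows "dag C f \<in> arrs C" "src C (dag C f) = trg C f" "trg C (dag C f) = src C f"
  using homsetD[OF dag_in_homset[OF homsetI[OF assms refl refl]]] by simp_all

declare dag_idn [simp] dag_dag [simp]

lemma dag_seqc_arr [simp]:
  "f \<in> arrs C \<Longrightarrow> g \<in> arrs C \<Longrightarrow> trg C f = src C g \<Longrightarrow> dag C (f \<Zsemi> g) = dag C g \<Zsemi> dag C f"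
  by (rule dag_seqc) (auto simp: homset_def)

lemma hom_monoid_simps [simp]:
  "carrier (hom_monoid C A B) = homset C A B" "monoid.mult (hom_monoid C A B) = hadd C"
  "one (hom_monoid C A B) = hzero C A B"
  by (simp_all add: hom_monoid_def)

lemma hzero_arrs [simp]:
  assumes "A \<in> objs C" "B \<in> objs C"
  shows "hzero C A B \<in> arrs C" "src C (hzero C A B) = A" "trg C (hzero C A B) = B"
  using homsetD[OF monoid.one_closed[OF comm_monoid.axioms(1)[OF hom_comm_monoid[OF assms]],
      unfolded hom_monoid_simps]] by simp_all

lemma hadd_arrs [simp]:
  assumes "f \<in> arrs C" "g \<in> arrs C" "src C f = src C g" "trg C f = trg C g"
  shows "f \<boxplus> g \<in> arrs C" "src C (f \<boxplus> g) = src C f" "trg C (f \<boxplus> g) = trg C f"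
proof -
  interpret M: comm_monoid "hom_monoid C (src C f) (trg C f)"
    using assms by (intro hom_comm_monoid) auto
  have "f \<boxplus> g \<in> homset C (src C f) (trg C f)"
    using M.m_closed[of f g] assms by (auto simp: homset_def)
  then show "f \<boxplus> g \<in> arrs C" "src C (f \<boxplus> g) = src C f" "trg C (f \<boxplus> g) = trg C f"
    by (auto simp: homset_def)
qed

lemma hadd_assoc:
  assumes "f \<in> arrs C" "g \<in> arrs C" "h \<in> arrs C" "src C f = src C g" "trg C f = trg C g"
    "src C g = src C h" "trg C g = trg C h"
  shows "(f \<boxplus> g) \<boxplus> h = f \<boxplus> (g \<boxplus> h)"
proof -
  interpret M: comm_monoid "hom_monoid C (src C f) (trg C f)"
    using assms by (intro hom_comm_monoid) auto
  show ?thesis using M.m_assoc[of f g h] assms by (simp add: homset_def)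
qed

lemma hadd_comm:
  assumes "f \<in> arrs C" "g \<in> arrs C" "src C f = src C g" "trg C f = trg C g"
  shows "f \<boxplus> g = g \<boxplus> f"
proof -
  interpret M: comm_monoid "hom_monoid C (src C f) (trg C f)"
    using assms by (intro hom_comm_monoid) auto
  show ?thesis using M.m_comm[of f g] assms by (simp add: homset_def)
qed

lemma hadd_lcomm:
  assumes "f \<in> arrs C" "g \<in> arrs C" "h \<in> arrs C" "src C f = src C g" "trg C f = trg C g"
    "src C g = src C h" "trg C g = trg C h"
  shows "f \<boxplus> (g \<boxplus> h) = g \<boxplus> (f \<boxplus> h)"
  using hadd_assoc[of f g h] hadd_assoc[of g f h] hadd_comm[of f g] assms by simp

lemmas hadd_ac = hadd_assoc hadd_comm hadd_lcomm

lemma hzero_hadd [simp]: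
  assumes "f \<in> arrs C" "src C f = A" "trg C f = B"
  shows "hzero C A B \<boxplus> f = f" "f \<boxplus> hzero C A B = f"
proof -
  interpret M: comm_monoid "hom_monoid C A B"
    using assms by (intro hom_comm_monoid) auto
  show "hzero C A B \<boxplus> f = f" "f \<boxplus> hzero C A B = f"
    using M.l_one[of f] M.r_one[of f] assms by (simp_all add: homset_def)
qed

lemma hadd_seqc_arr [simp]:
  assumes "f \<in> arrs C" "g \<in> arrs C" "h \<in> arrs C" "src C f = src C g" "trg C f = src C h" "trg C g = src C h"
  shows "(f \<boxplus> g) \<Zsemi> h = f \<Zsemi> h \<boxplus> g \<Zsemi> h"
  using assms by (intro hadd_seqc) (auto simp: homset_def)

lemma seqc_hadd_arr [simp]:
  assumes "f \<in> arrs C" "g \<in> arrs C" "h \<in> arrs C" "trg C f = trg C g" "trg C h = src C f" "trg C h = src C g"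
  shows "h \<Zsemi> (f \<boxplus> g) = h \<Zsemi> f \<boxplus> h \<Zsemi> g"
  using assms by (intro seqc_hadd) (auto simp: homset_def)

lemma hzero_seqc_arr [simp]:
  "A \<in> objs C \<Longrightarrow> f \<in> arrs C \<Longrightarrow> src C f = B \<Longrightarrow> hzero C A B \<Zsemi> f = hzero C A (trg C f)"
  by (rule hzero_seqc) (auto simp: homset_def)

lemma seqc_hzero_arr [simp]:
  "A \<in> objs C \<Longrightarrow> f \<in> arrs C \<Longrightarrow> trg C f = B \<Longrightarrow> f \<Zsemi> hzero C B A = hzero C (src C f) A"
  by (rule seqc_hzero) (auto simp: homset_def)

section \<open>Dagger equalisers, dagger biproducts and projection matrices\<close>

lemma arrow_graph_dagger_limit:
  fixes K :: "nat set"
  assumes A: "A \<in> objs C" and B: "B \<in> objs C" and f: "\<And>k. k \<in> K \<Longrightarrow> f k \<in> homset C A B"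
    and K: "finite K"
  obtains L p q where "p \<in> homset C L A" "q \<in> homset C L B"
    and "\<forall>k\<in>K. p \<Zsemi> f k = q"
    and "\<forall>M. \<forall>h\<in>homset C M A. \<forall>g\<in>homset C M B. (\<forall>k\<in>K. h \<Zsemi> f k = g) \<longrightarrow>
      (\<exists>u\<in>homset C M L. u \<Zsemi> p = h \<and> u \<Zsemi> q = g)"
    and "(if K = {} then p \<Zsemi> dag C p \<boxplus> q \<Zsemi> dag C q else p \<Zsemi> dag C p) = idn C L"
proof -
  let ?A = "\<lambda>S::nat. if S = 0 then A else B"
  let ?J = "free_category (arrow_graph K)"
  let ?F = "\<lambda>(u, p, v). if p = [] then idn C (?A u) else f (hd p)"
  have objs: "objs ?J = {0, 1}" by (simp add: free_category_def)
  \<comment> \<open>The identity walks impose nothing beyond the typing, so a cone is a pair of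
    arrows compatible with the arcs.\<close>
  have cone: "is_cone ?J C ?A ?F M m \<longleftrightarrow> m 0 \<in> homset C M A \<and> m 1 \<in> homset C M B
    \<and> (\<forall>k\<in>K. m 0 \<Zsemi> f k = m 1)" for M m
  proof -
    have arrs: "arrs ?J = {(0, [], 0), (1, [], 1)} \<union> (\<lambda>k. (0, [k], 1)) ` K"
      by (auto simp: free_category_def awalk_arrow_graph)
    have st: "src ?J (u, p, v) = u" "trg ?J (u, p, v) = v" for u p v
      by (simp_all add: free_category_def)
    show ?thesis
      unfolding is_cone_def arrs objs ball_Un st
      using homsetD[of "m 0" M A] homsetD[of "m 1" M B] by (auto simp: st)
  qed
  have "cat_functor ?J C ?A ?F"
    using assms by (intro cat_functor_arrow_graph) auto
  then obtain L l where lim: "is_limit ?J C ?A ?F L l"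
    and fin: "finprod (hom_monoid C L L) (\<lambda>S. l S \<Zsemi> dag C (l S)) (leaves ?J) = idn C L"
    using finite_dagger_limits finite_forest_multigraph_arrow_graph[OF K]
    unfolding has_finite_dagger_limits_def is_dagger_limit_def by blast
  have l: "l 0 \<in> homset C L A" "l 1 \<in> homset C L B" "\<And>k. k \<in> K \<Longrightarrow> l 0 \<Zsemi> f k = l 1"
    using lim unfolding is_limit_def cone by auto
  note lD = homsetD[OF l(1)] homsetD[OF l(2)]
  interpret M: comm_monoid "hom_monoid C L L"
    using lD by (intro hom_comm_monoid) auto
  have p: "l 0 \<Zsemi> dag C (l 0) \<in> homset C L L" "l 1 \<Zsemi> dag C (l 1) \<in> homset C L L"
    using lD by (auto simp: homset_def)
  show ?thesis
  proof (rule that[of "l 0" L "l 1"])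
    show "(if K = {} then l 0 \<Zsemi> dag C (l 0) \<boxplus> l 1 \<Zsemi> dag C (l 1) else l 0 \<Zsemi> dag C (l 0)) = idn C L"
      unfolding fin[symmetric] leaves_arrow_graph using p homsetD[OF p(1)] homsetD[OF p(2)]
      by (simp add: M.finprod_insert)
    have "\<exists>u\<in>homset C M L. u \<Zsemi> l 0 = h \<and> u \<Zsemi> l 1 = g"
      if "h \<in> homset C M A" "g \<in> homset C M B" "\<forall>k\<in>K. h \<Zsemi> f k = g" for M h g
    proof -
      have "is_cone ?J C ?A ?F M (\<lambda>S. if S = 0 then h else g)" using that by (simp add: cone)
      then have "\<exists>!u. u \<in> homset C M L \<and> (\<forall>S\<in>{0, 1}. u \<Zsemi> l S = (if S = 0 then h else g))"
        using lim unfolding is_limit_def objs by blast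
      then show ?thesis by auto
    qed
    then show "\<forall>M. \<forall>h\<in>homset C M A. \<forall>g\<in>homset C M B. (\<forall>k\<in>K. h \<Zsemi> f k = g) \<longrightarrow>
        (\<exists>u\<in>homset C M L. u \<Zsemi> l 0 = h \<and> u \<Zsemi> l 1 = g)"
      by blast
  qed (use l in auto)
qed

text \<open>The arrow \<open>e\<close> is an isometry, so an equalising \<open>h\<close>, which
  factors as \<open>u e\<close>, satisfies \<open>h (dag e) e = u e (dag e) e = u e = h\<close>. In
  this form the universal property is a statement about the idempotent of \<open>e\<close>.\<close>

lemma dagger_equaliser:
  assumes f: "f \<in> homset C A B" and g: "g \<in> homset C A B"
  obtains E e where "e \<in> homset C E A" "e \<Zsemi> f = e \<Zsemi> g" "e \<Zsemi> dag C e = idn C E"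
    and "\<forall>X. \<forall>h\<in>homset C X A. h \<Zsemi> f = h \<Zsemi> g \<longrightarrow> h \<Zsemi> (dag C e \<Zsemi> e) = h"
proof -
  let ?F = "\<lambda>k::nat. if k = 0 then f else g"
  note D = homsetD[OF f] homsetD[OF g]
  have F: "\<And>k. k \<in> {0, 1} \<Longrightarrow> ?F k \<in> homset C A B" "finite {0::nat, 1}"
    using f g by auto
  obtain L e q where e: "e \<in> homset C L A" and q: "q \<in> homset C L B"
    and eq: "\<forall>k\<in>{0, 1}. e \<Zsemi> ?F k = q"
    and un: "\<forall>M. \<forall>h\<in>homset C M A. \<forall>r\<in>homset C M B. (\<forall>k\<in>{0, 1}. h \<Zsemi> ?F k = r) \<longrightarrow>
      (\<exists>u\<in>homset C M L. u \<Zsemi> e = h \<and> u \<Zsemi> q = r)"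
    and fin: "(if {0::nat, 1} = {} then e \<Zsemi> dag C e \<boxplus> q \<Zsemi> dag C q else e \<Zsemi> dag C e) = idn C L"
    by (rule arrow_graph_dagger_limit[OF D(4,5) F])
  note eD = homsetD[OF e]
  have iso: "e \<Zsemi> dag C e = idn C L" using fin by simp
  show ?thesis
  proof (rule that[OF e _ iso])
    show "e \<Zsemi> f = e \<Zsemi> g" using eq by simp
    have "h \<Zsemi> (dag C e \<Zsemi> e) = h" if h: "h \<in> homset C X A" "h \<Zsemi> f = h \<Zsemi> g" for X h
    proof -
      have "h \<Zsemi> f \<in> homset C X B" using homsetD[OF h(1)] D by (auto simp: homset_def)
      moreover have "\<forall>k\<in>{0, 1}. h \<Zsemi> ?F k = h \<Zsemi> f" using h(2) by simp
      ultimately have "\<exists>u\<in>homset C X L. u \<Zsemi> e = h \<and> u \<Zsemi> q = h \<Zsemi> f"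
        using un h(1) by blast
      then obtain u where u: "u \<in> homset C X L" "h = u \<Zsemi> e" by blast
      show ?thesis
        using homsetD[OF u(1)] eD by (simp add: u(2) reassoc[OF iso])
    qed
    then show "\<forall>X. \<forall>h\<in>homset C X A. h \<Zsemi> f = h \<Zsemi> g \<longrightarrow> h \<Zsemi> (dag C e \<Zsemi> e) = h" by blast
  qed
qed

text \<open>The universal property gives injections with components \<open>(1, 0)\<close> and
  \<open>(0, 1)\<close>; the normalisation identifies them with the daggers of the projections,
  which yields the orthogonality relations.\<close>

lemma dagger_biproduct:
  assumes A: "A \<in> objs C" and B: "B \<in> objs C"
  obtains L p q where "p \<in> homset C L A" "q \<in> homset C L B"
    and "p \<Zsemi> dag C p \<boxplus> q \<Zsemi> dag C q = idn C L"
    and "dag C p \<Zsemi> p = idn C A" "dag C q \<Zsemi> q = idn C B"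
    and "dag C p \<Zsemi> q = hzero C A B" "dag C q \<Zsemi> p = hzero C B A"
proof -
  \<comment> \<open>There are no arcs, so \<open>undefined\<close> stands for the empty family of
    arrows.\<close>
  have F: "\<And>k. k \<in> {} \<Longrightarrow> undefined k \<in> homset C A B" "finite ({} :: nat set)" by auto
  obtain L p q where pq: "p \<in> homset C L A" "q \<in> homset C L B"
    and "\<forall>k\<in>({}::nat set). p \<Zsemi> undefined k = q"
    and un: "\<forall>M. \<forall>h\<in>homset C M A. \<forall>g\<in>homset C M B. (\<forall>k\<in>({}::nat set). h \<Zsemi> undefined k = g) \<longrightarrow>
      (\<exists>u\<in>homset C M L. u \<Zsemi> p = h \<and> u \<Zsemi> q = g)"
    and fin: "(if {} = ({}::nat set) then p \<Zsemi> dag C p \<boxplus> q \<Zsemi> dag C q else p \<Zsemi> dag C p) = idn C L"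
    by (rule arrow_graph_dagger_limit[OF A B F])
  note D = homsetD[OF pq(1)] homsetD[OF pq(2)]
  have id: "p \<Zsemi> dag C p \<boxplus> q \<Zsemi> dag C q = idn C L" using fin by simp
  have exp: "u = (u \<Zsemi> p) \<Zsemi> dag C p \<boxplus> (u \<Zsemi> q) \<Zsemi> dag C q" if "u \<in> homset C M L" for u M
  proof -
    have "u = u \<Zsemi> (p \<Zsemi> dag C p \<boxplus> q \<Zsemi> dag C q)"
      unfolding id using homsetD[OF that] by simp
    then show ?thesis using homsetD[OF that] D by simp
  qed
  obtain u where u: "u \<in> homset C A L" "u \<Zsemi> p = idn C A" "u \<Zsemi> q = hzero C A B"
    using un[rule_format, of "idn C A" A "hzero C A B"] A B by (auto simp: homset_def)
  obtain v where v: "v \<in> homset C B L" "v \<Zsemi> p = hzero C B A" "v \<Zsemi> q = idn C B"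
    using un[rule_format, of "hzero C B A" B "idn C B"] A B by (auto simp: homset_def)
  \<comment> \<open>Expanding \<open>u\<close> and \<open>v\<close> along the resolution of the
    identity, with their components \<open>(1, 0)\<close> and \<open>(0, 1)\<close>, leaves one term
    each.\<close>
  have "u = dag C p" "v = dag C q" using exp[OF u(1)] exp[OF v(1)] D A B by (simp_all add: u v)
  with u v pq id that show ?thesis by simp
qed

text \<open>Both zero arrows are mixed composites of the biproduct of \<open>A\<close> and
  \<open>B\<close>, and the dagger exchanges the two composites.\<close>

lemma dag_hzero [simp]:
  assumes A: "A \<in> objs C" and B: "B \<in> objs C"
  shows "dag C (hzero C A B) = hzero C B A"
proof (rule dagger_biproduct[OF A B])
  fix L p q assume pq: "p \<in> homset C L A" "q \<in> homset C L B"
    and eq: "dag C p \<Zsemi> q = hzero C A B" "dag C q \<Zsemi> p = hzero C B A"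
  show ?thesis
    using homsetD[OF pq(1)] homsetD[OF pq(2)] unfolding eq[symmetric] by simp
qed

text \<open>The sum \<open>f + g\<close> factors as the pairing \<open>u\<close> of \<open>f\<close>
  and \<open>g\<close> followed by the codiagonal \<open>d\<close> of a biproduct. The dagger of
  \<open>d\<close> has both components \<open>1\<close>, so it is the diagonal, and composing it
  with the dagger of \<open>u\<close> adds the daggers of the components of
  \<open>u\<close>.\<close>

lemma dag_hadd [simp]:
  assumes "f \<in> arrs C" "g \<in> arrs C" "src C f = src C g" "trg C f = trg C g"
  shows "dag C (f \<boxplus> g) = dag C f \<boxplus> dag C g"
proof -
  let ?B = "trg C f"
  have B: "?B \<in> objs C" using assms by simp
  obtain L p q where pq: "p \<in> homset C L ?B" "q \<in> homset C L ?B"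
    and id: "p \<Zsemi> dag C p \<boxplus> q \<Zsemi> dag C q = idn C L"
    and eq: "dag C p \<Zsemi> p = idn C ?B" "dag C q \<Zsemi> q = idn C ?B"
    "dag C p \<Zsemi> q = hzero C ?B ?B" "dag C q \<Zsemi> p = hzero C ?B ?B"
    by (rule dagger_biproduct[OF B B]) 
  note D = homsetD[OF pq(1)] homsetD[OF pq(2)]
  note r = eq[THEN reassoc]
  define u where "u = f \<Zsemi> dag C p \<boxplus> g \<Zsemi> dag C q"
  define d where "d = p \<boxplus> q"
  have u: "u \<in> arrs C" "src C u = src C f" "trg C u = L" using assms D by (simp_all add: u_def)
  have d: "d \<in> arrs C" "src C d = L" "trg C d = ?B" using assms D by (simp_all add: d_def)
  have "f \<boxplus> g = u \<Zsemi> d" using assms D by (simp add: u_def d_def eq r)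
  have up: "u \<Zsemi> p = f" "u \<Zsemi> q = g" using assms D by (simp_all add: u_def eq r)
  have "dag C p \<Zsemi> d = idn C ?B" "dag C q \<Zsemi> d = idn C ?B" using D by (simp_all add: d_def eq)
  moreover have "dag C d \<Zsemi> p = dag C (dag C p \<Zsemi> d)" "dag C d \<Zsemi> q = dag C (dag C q \<Zsemi> d)"
    using D d by simp_all
  ultimately have "dag C d \<Zsemi> p = idn C ?B" "dag C d \<Zsemi> q = idn C ?B"
    using B by simp_all
  note dp = this this[THEN reassoc]
  have "dag C (f \<boxplus> g) = dag C d \<Zsemi> (p \<Zsemi> dag C p \<boxplus> q \<Zsemi> dag C q) \<Zsemi> dag C u"
    unfolding id \<open>f \<boxplus> g = u \<Zsemi> d\<close> using u d by simp
  also have "\<dots> = dag C p \<Zsemi> dag C u \<boxplus> dag C q \<Zsemi> dag C u"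
    using u d D by (simp add: dp)
  also have "\<dots> = dag C (u \<Zsemi> p) \<boxplus> dag C (u \<Zsemi> q)"
    using u D by simp
  finally show ?thesis unfolding up .
qed

text \<open>The equaliser of the row vectors \<open>(u1, u2)\<close> and \<open>(v1, v2)\<close>, as a subobject of the biproduct
  \<open>B \<oplus> B\<close>, is encoded by the entries of its self-adjoint projection matrix.\<close>

lemma equaliser_projection_matrix:
  assumes u: "u1 \<in> homset C B D" "u2 \<in> homset C B D" and v: "v1 \<in> homset C B D" "v2 \<in> homset C B D"
  obtains p q q' r where "p \<in> homset C B B" "q \<in> homset C B B" "q' \<in> homset C B B" "r \<in> homset C B B"
    and "dag C p = p" "dag C q = q'" "dag C r = r"
    and "p \<Zsemi> u1 \<boxplus> q \<Zsemi> u2 = p \<Zsemi> v1 \<boxplus> q \<Zsemi> v2"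
    and "q' \<Zsemi> u1 \<boxplus> r \<Zsemi> u2 = q' \<Zsemi> v1 \<boxplus> r \<Zsemi> v2"
    and "\<forall>X. \<forall>f\<in>homset C X B. \<forall>g\<in>homset C X B. f \<Zsemi> u1 \<boxplus> g \<Zsemi> u2 = f \<Zsemi> v1 \<boxplus> g \<Zsemi> v2 \<longrightarrow>
      f \<Zsemi> p \<boxplus> g \<Zsemi> q' = f \<and> f \<Zsemi> q \<boxplus> g \<Zsemi> r = g"
proof -
  note D = homsetD[OF u(1)] homsetD[OF u(2)] homsetD[OF v(1)] homsetD[OF v(2)]
  obtain L s t where st: "s \<in> homset C L B" "t \<in> homset C L B"
    and id: "s \<Zsemi> dag C s \<boxplus> t \<Zsemi> dag C t = idn C L"
    and eq: "dag C s \<Zsemi> s = idn C B" "dag C t \<Zsemi> t = idn C B"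
    "dag C s \<Zsemi> t = hzero C B B" "dag C t \<Zsemi> s = hzero C B B"
    by (rule dagger_biproduct[OF D(4,4)])
  note sD = homsetD[OF st(1)] homsetD[OF st(2)]
  note r = eq[THEN reassoc]
  define u where "u = s \<Zsemi> u1 \<boxplus> t \<Zsemi> u2"
  define v where "v = s \<Zsemi> v1 \<boxplus> t \<Zsemi> v2"
  have uv: "u \<in> homset C L D" "v \<in> homset C L D" using D sD by (simp_all add: u_def v_def homset_def)
  obtain E e where e: "e \<in> homset C E L" and eeq: "e \<Zsemi> u = e \<Zsemi> v" and "e \<Zsemi> dag C e = idn C E"
    and fixed: "\<forall>X. \<forall>h\<in>homset C X L. h \<Zsemi> u = h \<Zsemi> v \<longrightarrow> h \<Zsemi> (dag C e \<Zsemi> e) = h"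
    by (rule dagger_equaliser[OF uv])
  note eD = homsetD[OF e]
  \<comment> \<open>As \<open>e\<close> is an isometry, \<open>P\<close> is a self-adjoint
    idempotent; it equalises \<open>u\<close> and \<open>v\<close>, and every arrow that does so is
    fixed by composition with it.\<close>
  define P where "P = dag C e \<Zsemi> e"
  have P: "P \<in> arrs C" "src C P = L" "trg C P = L" "dag C P = P" using eD by (simp_all add: P_def)
  have "P \<Zsemi> u = P \<Zsemi> v" using eD eeq homsetD[OF uv(1)] homsetD[OF uv(2)] by (simp add: P_def)
  then have Puv: "P \<Zsemi> (s \<Zsemi> u1) \<boxplus> P \<Zsemi> (t \<Zsemi> u2) = P \<Zsemi> (s \<Zsemi> v1) \<boxplus> P \<Zsemi> (t \<Zsemi> v2)"
    using P D sD by (simp add: u_def v_def)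
  show ?thesis
  proof (rule that[of "dag C s \<Zsemi> (P \<Zsemi> s)" "dag C s \<Zsemi> (P \<Zsemi> t)" "dag C t \<Zsemi> (P \<Zsemi> s)" "dag C t \<Zsemi> (P \<Zsemi> t)"])
    show "(dag C s \<Zsemi> (P \<Zsemi> s)) \<Zsemi> u1 \<boxplus> (dag C s \<Zsemi> (P \<Zsemi> t)) \<Zsemi> u2 =
        (dag C s \<Zsemi> (P \<Zsemi> s)) \<Zsemi> v1 \<boxplus> (dag C s \<Zsemi> (P \<Zsemi> t)) \<Zsemi> v2"
      using arg_cong[OF Puv, of "\<lambda>z. dag C s \<Zsemi> z"] P D sD by simp
    show "(dag C t \<Zsemi> (P \<Zsemi> s)) \<Zsemi> u1 \<boxplus> (dag C t \<Zsemi> (P \<Zsemi> t)) \<Zsemi> u2 =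
        (dag C t \<Zsemi> (P \<Zsemi> s)) \<Zsemi> v1 \<boxplus> (dag C t \<Zsemi> (P \<Zsemi> t)) \<Zsemi> v2"
      using arg_cong[OF Puv, of "\<lambda>z. dag C t \<Zsemi> z"] P D sD by simp
    have "f \<Zsemi> (dag C s \<Zsemi> (P \<Zsemi> s)) \<boxplus> g \<Zsemi> (dag C t \<Zsemi> (P \<Zsemi> s)) = f
      \<and> f \<Zsemi> (dag C s \<Zsemi> (P \<Zsemi> t)) \<boxplus> g \<Zsemi> (dag C t \<Zsemi> (P \<Zsemi> t)) = g"
      if f: "f \<in> homset C X B" and g: "g \<in> homset C X B"
        and fg: "f \<Zsemi> u1 \<boxplus> g \<Zsemi> u2 = f \<Zsemi> v1 \<boxplus> g \<Zsemi> v2" for X f g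
    proof -
      note fD = homsetD[OF f] homsetD[OF g]
      \<comment> \<open>The arrow into the biproduct with components \<open>f\<close> and
        \<open>g\<close>; its fixedness under \<open>P\<close>, read in components, gives the two
        equations.\<close>
      define w where "w = f \<Zsemi> dag C s \<boxplus> g \<Zsemi> dag C t"
      have w: "w \<in> homset C X L" using fD sD by (simp add: w_def homset_def)
      have "w \<Zsemi> u = w \<Zsemi> v" using fD sD D fg by (simp add: w_def u_def v_def eq r)
      then have "w \<Zsemi> P = w" using fixed[rule_format, OF w] by (simp add: P_def)
      then have "(w \<Zsemi> P) \<Zsemi> s = f" "(w \<Zsemi> P) \<Zsemi> t = g" using fD sD by (simp_all add: w_def eq)
      then show ?thesis using fD sD P by (simp add: w_def)
    qed
    then show "\<forall>X. \<forall>f\<in>homset C X B. \<forall>g\<in>homset C X B. f \<Zsemi> u1 \<boxplus> g \<Zsemi> u2 = f \<Zsemi> v1 \<boxplus> g \<Zsemi> v2 \<longrightarrow>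
      f \<Zsemi> (dag C s \<Zsemi> (P \<Zsemi> s)) \<boxplus> g \<Zsemi> (dag C t \<Zsemi> (P \<Zsemi> s)) = f
      \<and> f \<Zsemi> (dag C s \<Zsemi> (P \<Zsemi> t)) \<boxplus> g \<Zsemi> (dag C t \<Zsemi> (P \<Zsemi> t)) = g"
      by blast
  qed (use P D sD in \<open>auto simp: homset_def\<close>)
qed

text \<open>For the row vectors \<open>(f, g)\<close> and \<open>(f, h)\<close> the pair
  \<open>(1, 0)\<close> is equalised trivially, so the projection fixes it and \<open>q = 0\<close>;
  then \<open>q' = 0\<close> by self-adjointness. The hypothesis says that \<open>(1, 1)\<close> is
  equalised too, which gives \<open>r = 1\<close>. The second row of the matrix is now
  \<open>(0, 1)\<close>, and that it is equalised means \<open>g = h\<close>.\<close>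

lemma hadd_left_cancel:
  assumes f: "f \<in> homset C A B" and g: "g \<in> homset C A B" and h: "h \<in> homset C A B"
    and eq: "f \<boxplus> g = f \<boxplus> h"
  shows "g = h"
proof -
  note D = homsetD[OF f] homsetD[OF g] homsetD[OF h]
  have id: "idn C A \<in> homset C A A" "hzero C A A \<in> homset C A A" using D by (simp_all add: homset_def)
  obtain p q q' r where pq: "p \<in> homset C A A" "q \<in> homset C A A" "q' \<in> homset C A A" "r \<in> homset C A A"
    and dag: "dag C p = p" "dag C q = q'" "dag C r = r"
    and "p \<Zsemi> f \<boxplus> q \<Zsemi> g = p \<Zsemi> f \<boxplus> q \<Zsemi> h"
    and e: "q' \<Zsemi> f \<boxplus> r \<Zsemi> g = q' \<Zsemi> f \<boxplus> r \<Zsemi> h"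
    and fixed: "\<forall>X. \<forall>k\<in>homset C X A. \<forall>l\<in>homset C X A. k \<Zsemi> f \<boxplus> l \<Zsemi> g = k \<Zsemi> f \<boxplus> l \<Zsemi> h \<longrightarrow>
      k \<Zsemi> p \<boxplus> l \<Zsemi> q' = k \<and> k \<Zsemi> q \<boxplus> l \<Zsemi> r = l"
    by (rule equaliser_projection_matrix[OF f g f h])
  note pD = homsetD[OF pq(1)] homsetD[OF pq(2)] homsetD[OF pq(3)] homsetD[OF pq(4)]
  have q: "q = hzero C A A" using fixed[rule_format, OF id(1,2)] D pD by simp
  then have "q' = hzero C A A" using dag(2) pD by simp
  moreover have "r = idn C A" using fixed[rule_format, OF id(1,1)] D pD eq by (simp add: q)
  ultimately show ?thesis using e D by simp
qed

text \<open>As addition commutes, the pair \<open>(1, 1)\<close> is equalised, hence fixed: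
  \<open>p + q' = 1\<close>. The adjoint equation is \<open>p + q = 1\<close>, so
  \<open>q' = q\<close> by cancellation. For a fixed pair \<open>(f, g)\<close> the equation
  \<open>f p + g q = f = f p + f q\<close> then cancels to \<open>g q = f q\<close>. Over a ring the
  complementary projection would be [[q, -q], [-q, q]], so \<open>2 q\<close> would be a projection,
  killed by \<open>f - g\<close> exactly when \<open>w - z\<close> is.\<close>

lemma equaliser_projection_swap:
  assumes w: "w \<in> homset C B D" and z: "z \<in> homset C B D"
  obtains p q where "p \<in> homset C B B" "q \<in> homset C B B" "dag C q = q"
    and "p \<boxplus> q = idn C B" "p \<Zsemi> w \<boxplus> q \<Zsemi> z = p \<Zsemi> z \<boxplus> q \<Zsemi> w"
    and "\<forall>X. \<forall>f\<in>homset C X B. \<forall>g\<in>homset C X B. f \<Zsemi> w \<boxplus> g \<Zsemi> z = f \<Zsemi> z \<boxplus> g \<Zsemi> w \<longrightarrow>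
      f \<Zsemi> q = g \<Zsemi> q"
proof -
  note D = homsetD[OF w] homsetD[OF z]
  have id: "idn C B \<in> homset C B B" using D by (simp add: homset_def)
  obtain p q q' r where pq: "p \<in> homset C B B" "q \<in> homset C B B" "q' \<in> homset C B B" "r \<in> homset C B B"
    and dag: "dag C p = p" "dag C q = q'" "dag C r = r"
    and e: "p \<Zsemi> w \<boxplus> q \<Zsemi> z = p \<Zsemi> z \<boxplus> q \<Zsemi> w"
    and "q' \<Zsemi> w \<boxplus> r \<Zsemi> z = q' \<Zsemi> z \<boxplus> r \<Zsemi> w"
    and fixed: "\<forall>X. \<forall>k\<in>homset C X B. \<forall>l\<in>homset C X B. k \<Zsemi> w \<boxplus> l \<Zsemi> z = k \<Zsemi> z \<boxplus> l \<Zsemi> w \<longrightarrow>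
      k \<Zsemi> p \<boxplus> l \<Zsemi> q' = k \<and> k \<Zsemi> q \<boxplus> l \<Zsemi> r = l"
    by (rule equaliser_projection_matrix[OF w z z w])
  note pD = homsetD[OF pq(1)] homsetD[OF pq(2)] homsetD[OF pq(3)] homsetD[OF pq(4)]
  have 1: "p \<boxplus> q' = idn C B" using fixed[rule_format, OF id id] D pD hadd_comm[of w z] by simp
  have "dag C (p \<boxplus> q') = p \<boxplus> q" using pD dag dag_dag[of q] by simp
  then have 2: "p \<boxplus> q = idn C B" using 1 D by simp
  have q': "q' = q" using hadd_left_cancel[OF pq(1,3,2)] 1 2 by simp
  show ?thesis
  proof (rule that[OF pq(1,2) _ 2 e])
    show "dag C q = q" using dag q' by simp
    have "f \<Zsemi> q = g \<Zsemi> q"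
      if f: "f \<in> homset C X B" and g: "g \<in> homset C X B"
        and fg: "f \<Zsemi> w \<boxplus> g \<Zsemi> z = f \<Zsemi> z \<boxplus> g \<Zsemi> w" for X f g
    proof -
      note fD = homsetD[OF f] homsetD[OF g]
      have "f \<Zsemi> p \<boxplus> g \<Zsemi> q = f \<Zsemi> (p \<boxplus> q)" using fixed[rule_format, OF f g fg] fD unfolding 2 q' by simp
      then have "f \<Zsemi> p \<boxplus> g \<Zsemi> q = f \<Zsemi> p \<boxplus> f \<Zsemi> q" using fD pD by simp
      then show ?thesis
        by (rule hadd_left_cancel[rotated 3, symmetric]) (use fD pD in \<open>auto simp: homset_def\<close>)
    qed
    then show "\<forall>X. \<forall>f\<in>homset C X B. \<forall>g\<in>homset C X B. f \<Zsemi> w \<boxplus> g \<Zsemi> z = f \<Zsemi> z \<boxplus> g \<Zsemi> w \<longrightarrow>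
        f \<Zsemi> q = g \<Zsemi> q"
      by blast
  qed
qed

text \<open>This converts \<open>q (w - z) = 0\<close> into \<open>w = z\<close>: equality of
  \<open>q w\<close> and \<open>q z\<close> reduces \<open>e\<close> to \<open>p w = p z\<close>,
  and the two equalities add up because \<open>p + q = 1\<close>.\<close>

lemma hadd_swap_cancel:
  assumes p: "p \<in> homset C B B" and q: "q \<in> homset C B B" and w: "w \<in> homset C B D" and z: "z \<in> homset C B D"
    and one: "p \<boxplus> q = idn C B" and e: "p \<Zsemi> w \<boxplus> q \<Zsemi> z = p \<Zsemi> z \<boxplus> q \<Zsemi> w"
    and q_eq: "q \<Zsemi> w = q \<Zsemi> z"
  shows "w = z"
proof -
  note D = homsetD[OF w] homsetD[OF z] homsetD[OF p] homsetD[OF q]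
  have "q \<Zsemi> z \<boxplus> p \<Zsemi> w = q \<Zsemi> z \<boxplus> p \<Zsemi> z"
    using e D by (simp add: q_eq hadd_comm)
  then have "p \<Zsemi> w = p \<Zsemi> z"
    by (rule hadd_left_cancel[rotated 3]) (use D in \<open>auto simp: homset_def\<close>)
  then have "(p \<boxplus> q) \<Zsemi> w = (p \<boxplus> q) \<Zsemi> z" using D q_eq by simp
  then show ?thesis unfolding one using D by simp
qed

text \<open>In terms of differences: \<open>(f - g) \<Zsemi> dag (f - g) = 0\<close> implies \<open>f = g\<close>.\<close>

lemma dag_difference_nondegenerate:
  assumes f: "f \<in> homset C A B" and g: "g \<in> homset C A B"
    and eq: "f \<Zsemi> dag C f \<boxplus> g \<Zsemi> dag C g = f \<Zsemi> dag C g \<boxplus> g \<Zsemi> dag C f"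
  shows "f = g"
proof -
  note D = homsetD[OF f] homsetD[OF g]
  have wz: "dag C f \<in> homset C B A" "dag C g \<in> homset C B A" using D by (simp_all add: homset_def)
  obtain p q where pq: "p \<in> homset C B B" "q \<in> homset C B B" and dq: "dag C q = q"
    and one: "p \<boxplus> q = idn C B" and e: "p \<Zsemi> dag C f \<boxplus> q \<Zsemi> dag C g = p \<Zsemi> dag C g \<boxplus> q \<Zsemi> dag C f"
    and cancel: "\<forall>X. \<forall>k\<in>homset C X B. \<forall>l\<in>homset C X B.
        k \<Zsemi> dag C f \<boxplus> l \<Zsemi> dag C g = k \<Zsemi> dag C g \<boxplus> l \<Zsemi> dag C f \<longrightarrow> k \<Zsemi> q = l \<Zsemi> q"
    by (rule equaliser_projection_swap[OF wz])
  note pD = homsetD[OF pq(1)] homsetD[OF pq(2)]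
  \<comment> \<open>The hypothesis \<open>eq\<close> is the premise of \<open>cancel\<close> for
    \<open>k = f\<close> and \<open>l = g\<close>. Taking daggers moves the self-adjoint
    \<open>q\<close> to the left, where \<open>hadd_swap_cancel\<close> expects it.\<close>
  have "dag C (f \<Zsemi> q) = dag C (g \<Zsemi> q)" using cancel[rule_format, OF f g eq] by simp
  then have "q \<Zsemi> dag C f = q \<Zsemi> dag C g" using D pD dq by simp
  then have "dag C f = dag C g" by (rule hadd_swap_cancel[OF pq wz one e])
  then show ?thesis using D dag_dag by metis
qed

end

section \<open>Scalars\<close>

context dagger_limit_category
begin

lemma monic_if_isometry:
  assumes e: "e \<in> homset C E A" and iso: "e \<Zsemi> dag C e = idn C E"
  shows "monic C e"
  unfolding monic_def
proof (intro conjI ballI impI)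
  note eD = homsetD[OF e]
  show "e \<in> arrs C" using eD by simp
  fix X f g assume "f \<in> homset C X (src C e)" "g \<in> homset C X (src C e)" and eq: "f \<Zsemi> e = g \<Zsemi> e"
  then have fg: "f \<in> homset C X E" "g \<in> homset C X E" using eD by auto
  note D = homsetD[OF fg(1)] homsetD[OF fg(2)]
  have "(f \<Zsemi> e) \<Zsemi> dag C e = (g \<Zsemi> e) \<Zsemi> dag C e" using eq by simp
  then show "f = g" using D eD by (simp add: iso)
qed

text \<open>The new vectors are \<open>(f, a)\<close> and \<open>(g, b)\<close> in the biproduct of
  \<open>B\<close> and \<open>D\<close>; orthogonality removes the mixed terms, so inner products
  add, and the second projection recovers \<open>a\<close> and \<open>b\<close>.\<close>

lemma direct_sum_vectors:
  assumes f: "f \<in> homset C A B" and g: "g \<in> homset C A B" and a: "a \<in> homset C A D" and b: "b \<in> homset C A D"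
  obtains L f' g' where "f' \<in> homset C A L" "g' \<in> homset C A L"
    and "f' \<Zsemi> dag C f' = f \<Zsemi> dag C f \<boxplus> a \<Zsemi> dag C a" "g' \<Zsemi> dag C g' = g \<Zsemi> dag C g \<boxplus> b \<Zsemi> dag C b"
    and "f' \<Zsemi> dag C g' = f \<Zsemi> dag C g \<boxplus> a \<Zsemi> dag C b" "g' \<Zsemi> dag C f' = g \<Zsemi> dag C f \<boxplus> b \<Zsemi> dag C a"
    and "f' = g' \<longrightarrow> a = b"
proof -
  note D = homsetD[OF f] homsetD[OF g] homsetD[OF a] homsetD[OF b]
  obtain L p q where pq: "p \<in> homset C L B" "q \<in> homset C L D"
    and "p \<Zsemi> dag C p \<boxplus> q \<Zsemi> dag C q = idn C L"
    and eq: "dag C p \<Zsemi> p = idn C B" "dag C q \<Zsemi> q = idn C D"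
    "dag C p \<Zsemi> q = hzero C B D" "dag C q \<Zsemi> p = hzero C D B"
    by (rule dagger_biproduct[OF D(5) D(15)])
  note pD = homsetD[OF pq(1)] homsetD[OF pq(2)]
  note r = eq[THEN reassoc]
  let ?f = "f \<Zsemi> dag C p \<boxplus> a \<Zsemi> dag C q" and ?g = "g \<Zsemi> dag C p \<boxplus> b \<Zsemi> dag C q"
  have q: "?f \<Zsemi> q = a" "?g \<Zsemi> q = b" using D pD by (simp_all add: eq)
  show ?thesis
  proof (rule that)
    show "?f \<in> homset C A L" "?g \<in> homset C A L" using D pD by (simp_all add: homset_def)
    show "?f = ?g \<longrightarrow> a = b" using q by metis
  qed (use D pD in \<open>simp_all add: eq r\<close>)
qed

end

locale simple_scalar_category = dagger_limit_category C + monoidal_category C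
  for C :: "('o, 'm, 'z) monoidal_dagger_category_scheme" (structure) +
  assumes simple: "simple_tensor_unit C"
    and zero_neq_one: "hzero C (tunit C) (tunit C) \<noteq> idn C (tunit C)"
begin

declare tunit_in_objs [simp]

abbreviation "scalar_set \<equiv> homset C (tunit C) (tunit C)"

text \<open>Interchange makes \<open>a \<odot> 1\<close> and \<open>1 \<odot> b\<close> commute. As the unitors at the unit object are not assumed
  to agree, transporting this along them only shows that \<open>a\<close> commutes with a conjugate of \<open>b\<close>,
  but every scalar is such a conjugate.\<close>

lemma scalars_commute:
  assumes a: "a \<in> scalar_set" and c: "c \<in> scalar_set"
  shows "a \<Zsemi> c = c \<Zsemi> a"
proof -
  let ?I = "tunit C" and ?II = "tunit C \<odot>\<^sub>o tunit C"
  let ?r = "runit C (tunit C)" and ?l = "lunit C (tunit C)"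
  note aD = homsetD[OF a] homsetD[OF c]
  note rl = homsetD[OF runit_in_homset[OF tunit_in_objs]] homsetD[OF lunit_in_homset[OF tunit_in_objs]]
  obtain r' where r': "r' \<in> homset C ?I ?II" and rr: "?r \<Zsemi> r' = idn C ?II" "r' \<Zsemi> ?r = idn C ?I"
    using runit_iso[OF tunit_in_objs] rl by (auto simp: isomorphism_def)
  obtain l' where l': "l' \<in> homset C ?I ?II" and ll: "?l \<Zsemi> l' = idn C ?II" "l' \<Zsemi> ?l = idn C ?I"
    using lunit_iso[OF tunit_in_objs] rl by (auto simp: isomorphism_def)
  note D = aD rl homsetD[OF r'] homsetD[OF l']
  note s = rr ll rr[THEN reassoc] ll[THEN reassoc]
  define \<phi> where "\<phi> = r' \<Zsemi> ?l"
  define \<psi> where "\<psi> = l' \<Zsemi> ?r"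
  have pp: "\<phi> \<Zsemi> \<psi> = idn C ?I" "\<psi> \<Zsemi> \<phi> = idn C ?I" and pD: "\<phi> \<in> arrs C" "src C \<phi> = ?I" "trg C \<phi> = ?I"
    "\<psi> \<in> arrs C" "src C \<psi> = ?I" "trg C \<psi> = ?I"
    using D by (simp_all add: \<phi>_def \<psi>_def s)
  define b where "b = \<psi> \<Zsemi> (c \<Zsemi> \<phi>)"
  have b: "b \<in> scalar_set" using pD D by (simp add: b_def homset_def)
  note bD = homsetD[OF b]
  let ?a = "a \<odot>\<^sub>a idn C ?I" and ?b = "idn C ?I \<odot>\<^sub>a b"
  have prod: "(f, g) \<in> homset (product_category C C) (?I, ?I) (?I, ?I)"
    if "f \<in> scalar_set" "g \<in> scalar_set" for f g
    using that by (auto simp: product_category_def homset_def)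
  have id: "idn C ?I \<in> scalar_set" by (rule idn_in_homset) simp
  note Fa = cat_functor.Fa_in_homset[OF tensor_functor prod] cat_functor.Fa_seqc[OF tensor_functor prod prod]
  have abD: "?a \<in> homset C ?II ?II" "?b \<in> homset C ?II ?II"
    using Fa(1)[OF a id] Fa(1)[OF id b] by simp_all
  have "?a \<Zsemi> ?b = ?b \<Zsemi> ?a"
    using Fa(2)[OF a id id b] Fa(2)[OF id b a id] bD aD by (simp add: product_category_def)
  moreover have "?a = ?r \<Zsemi> (a \<Zsemi> r')"
  proof -
    have "?a = (?a \<Zsemi> ?r) \<Zsemi> r'" using homsetD[OF abD(1)] D by (simp add: s)
    then show ?thesis unfolding runit_natural[OF a] using D by simp
  qed
  moreover have "?b = ?l \<Zsemi> (b \<Zsemi> l')"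
  proof -
    have "?b = (?b \<Zsemi> ?l) \<Zsemi> l'" using homsetD[OF abD(2)] D by (simp add: s)
    then show ?thesis unfolding lunit_natural[OF b] using D bD by simp
  qed
  \<comment> \<open>Sandwiching with the right unitor turns the two composites back into scalars: it
    strips the unitor from \<open>a\<close> and leaves \<open>b\<close> conjugated by
    \<open>\<phi>\<close>, which by the choice of \<open>b\<close> is \<open>c\<close>.\<close>
  ultimately have "r' \<Zsemi> ((?r \<Zsemi> (a \<Zsemi> r')) \<Zsemi> (?l \<Zsemi> (b \<Zsemi> l'))) \<Zsemi> ?r
      = r' \<Zsemi> ((?l \<Zsemi> (b \<Zsemi> l')) \<Zsemi> (?r \<Zsemi> (a \<Zsemi> r'))) \<Zsemi> ?r"
    by simp
  then have "a \<Zsemi> (\<phi> \<Zsemi> (b \<Zsemi> \<psi>)) = \<phi> \<Zsemi> (b \<Zsemi> (\<psi> \<Zsemi> a))"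
    using D bD by (simp add: s \<phi>_def \<psi>_def)
  moreover have "\<phi> \<Zsemi> (b \<Zsemi> \<psi>) = c"
    using pD D by (simp add: b_def pp pp[THEN reassoc])
  moreover have "\<phi> \<Zsemi> (b \<Zsemi> (\<psi> \<Zsemi> a)) = c \<Zsemi> a"
    using pD D by (simp add: b_def pp pp[THEN reassoc])
  ultimately show ?thesis by simp
qed

text \<open>The hypothesis makes \<open>a\<close> factor through the equaliser \<open>e\<close> of
  \<open>x\<close> and \<open>y\<close>. As \<open>a\<close> is nonzero so is \<open>e\<close>, and
  a nonzero subobject of the simple unit is an isomorphism, which forces
  \<open>x = y\<close>.\<close>

lemma scalar_mult_cancel:
  assumes a: "a \<in> scalar_set" and x: "x \<in> scalar_set" and y: "y \<in> scalar_set"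
    and nz: "a \<noteq> hzero C (tunit C) (tunit C)" and eq: "a \<Zsemi> x = a \<Zsemi> y"
  shows "x = y"
proof -
  let ?I = "tunit C"
  note D = homsetD[OF a] homsetD[OF x] homsetD[OF y]
  obtain E e where e: "e \<in> homset C E ?I" "e \<Zsemi> x = e \<Zsemi> y" "e \<Zsemi> dag C e = idn C E"
    and fixed: "\<forall>X. \<forall>h\<in>homset C X ?I. h \<Zsemi> x = h \<Zsemi> y \<longrightarrow> h \<Zsemi> (dag C e \<Zsemi> e) = h"
    by (rule dagger_equaliser[OF x y])
  note eD = homsetD[OF e(1)]
  have "a \<Zsemi> (dag C e \<Zsemi> e) = a" using fixed a eq by blast
  moreover have "a \<Zsemi> (dag C e \<Zsemi> hzero C E ?I) = hzero C ?I ?I" using D eD by simp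
  ultimately have "e \<noteq> hzero C E ?I" using nz by metis
  then have "isomorphism C e"
    using simple monic_if_isometry[OF e(1,3)] e(1) eD(4) unfolding simple_tensor_unit_def by blast
  then obtain g where g: "g \<in> homset C ?I E" "g \<Zsemi> e = idn C ?I"
    using eD by (auto simp: isomorphism_def)
  have "g \<Zsemi> (e \<Zsemi> x) = g \<Zsemi> (e \<Zsemi> y)" using e(2) by simp
  then show ?thesis using homsetD[OF g(1)] eD D by (simp add: reassoc[OF g(2)])
qed

text \<open>The hypothesis gives \<open>a q = b q\<close> for the entry \<open>q\<close> of the swap
  projection of \<open>c\<close> and \<open>d\<close>. If \<open>q = 0\<close>, then
  \<open>q c = q d\<close> holds trivially and \<open>c = d\<close> follows; otherwise
  \<open>q\<close> can be cancelled.\<close>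

lemma scalar_difference_integral:
  assumes a: "a \<in> scalar_set" and b: "b \<in> scalar_set" and c: "c \<in> scalar_set" and d: "d \<in> scalar_set"
    and eq: "a \<Zsemi> c \<boxplus> b \<Zsemi> d = a \<Zsemi> d \<boxplus> b \<Zsemi> c"
  shows "a = b \<or> c = d"
proof -
  let ?I = "tunit C"
  note D = homsetD[OF c] homsetD[OF d]
  obtain p q where p: "p \<in> scalar_set" and q: "q \<in> scalar_set" and "dag C q = q"
    and one: "p \<boxplus> q = idn C ?I" and e: "p \<Zsemi> c \<boxplus> q \<Zsemi> d = p \<Zsemi> d \<boxplus> q \<Zsemi> c"
    and cancel: "\<forall>X. \<forall>f\<in>homset C X ?I. \<forall>g\<in>homset C X ?I. f \<Zsemi> c \<boxplus> g \<Zsemi> d = f \<Zsemi> d \<boxplus> g \<Zsemi> c \<longrightarrow>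
      f \<Zsemi> q = g \<Zsemi> q"
    by (rule equaliser_projection_swap[OF c d])
  have "a \<Zsemi> q = b \<Zsemi> q" using cancel[rule_format, OF a b eq] .
  then have q_eq: "q \<Zsemi> a = q \<Zsemi> b" using scalars_commute a b q by metis
  show ?thesis
  proof (cases "q = hzero C ?I ?I")
    case True
    then have "q \<Zsemi> c = q \<Zsemi> d" using D by simp
    then show ?thesis using hadd_swap_cancel[OF p q c d one e] by blast
  next
    case False
    then show ?thesis using scalar_mult_cancel[OF q a b _ q_eq] by blast
  qed
qed

section \<open>Sums of norms of differences of scalars\<close>

lemma scalars_simps [simp]:
  "carrier (scalars C) = scalar_set" "monoid.mult (scalars C) = seqc C" "add (scalars C) = hadd C"
  "one (scalars C) = idn C (tunit C)" "zero (scalars C) = hzero C (tunit C) (tunit C)"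
  by (simp_all add: scalars_def)

text \<open>A sum of norms of differences becomes the norm of one difference of vectors. Their
  target is existentially quantified because it grows by a copy of the unit with each summand; the
  empty sum is represented by zero vectors.\<close>

lemma norm_sum_pairs_scalars:
  "(u, v) \<in> norm_sum_pairs (scalars C) (dag C) \<Longrightarrow> \<exists>B. \<exists>f\<in>homset C (tunit C) B. \<exists>g\<in>homset C (tunit C) B.
    u = f \<Zsemi> dag C f \<boxplus> g \<Zsemi> dag C g \<and> v = f \<Zsemi> dag C g \<boxplus> g \<Zsemi> dag C f"
proof (induction rule: norm_sum_pairs.induct)
  case zero
  have "hzero C (tunit C) (tunit C) \<in> scalar_set" by (simp add: homset_def)
  then show ?case by (intro exI[of _ "tunit C"] bexI[of _ "hzero C (tunit C) (tunit C)"]) auto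
next
  case (step u v a b)
  from step(4) obtain B f g where f: "f \<in> homset C (tunit C) B" and g: "g \<in> homset C (tunit C) B"
    and uv: "u = f \<Zsemi> dag C f \<boxplus> g \<Zsemi> dag C g" "v = f \<Zsemi> dag C g \<boxplus> g \<Zsemi> dag C f" by blast
  have ab: "a \<in> scalar_set" "b \<in> scalar_set" using step(2,3) by simp_all
  note D = homsetD[OF f] homsetD[OF g] homsetD[OF ab(1)] homsetD[OF ab(2)]
  obtain L f' g' where fg: "f' \<in> homset C (tunit C) L" "g' \<in> homset C (tunit C) L"
    and eq: "f' \<Zsemi> dag C f' = f \<Zsemi> dag C f \<boxplus> a \<Zsemi> dag C a" "g' \<Zsemi> dag C g' = g \<Zsemi> dag C g \<boxplus> b \<Zsemi> dag C b"
    "f' \<Zsemi> dag C g' = f \<Zsemi> dag C g \<boxplus> a \<Zsemi> dag C b" "g' \<Zsemi> dag C f' = g \<Zsemi> dag C f \<boxplus> b \<Zsemi> dag C a"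
    and "f' = g' \<longrightarrow> a = b"
    by (rule direct_sum_vectors[OF f g ab])
  have "u \<boxplus> (a \<Zsemi> dag C a \<boxplus> b \<Zsemi> dag C b) = f' \<Zsemi> dag C f' \<boxplus> g' \<Zsemi> dag C g'"
    "v \<boxplus> (a \<Zsemi> dag C b \<boxplus> b \<Zsemi> dag C a) = f' \<Zsemi> dag C g' \<boxplus> g' \<Zsemi> dag C f'"
    unfolding eq uv using D by (simp_all add: hadd_ac)
  with fg show ?case unfolding scalars_simps by blast
qed

text \<open>The last norm is given a coordinate of its own in a further biproduct, so that equality
  of the long vectors projects to \<open>a = b\<close>.\<close>

lemma scalar_difference_anisotropic:
  assumes uv: "(u, v) \<in> norm_sum_pairs (scalars C) (dag C)" and ab: "a \<in> scalar_set" "b \<in> scalar_set"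
    and e: "u \<boxplus> (a \<Zsemi> dag C a \<boxplus> b \<Zsemi> dag C b) = v \<boxplus> (a \<Zsemi> dag C b \<boxplus> b \<Zsemi> dag C a)"
  shows "a = b"
proof -
  obtain B f g where f: "f \<in> homset C (tunit C) B" and g: "g \<in> homset C (tunit C) B"
    and uv: "u = f \<Zsemi> dag C f \<boxplus> g \<Zsemi> dag C g" "v = f \<Zsemi> dag C g \<boxplus> g \<Zsemi> dag C f"
    using norm_sum_pairs_scalars[OF uv] by blast
  note D = homsetD[OF f] homsetD[OF g] homsetD[OF ab(1)] homsetD[OF ab(2)]
  obtain L f' g' where fg: "f' \<in> homset C (tunit C) L" "g' \<in> homset C (tunit C) L"
    and eq: "f' \<Zsemi> dag C f' = f \<Zsemi> dag C f \<boxplus> a \<Zsemi> dag C a" "g' \<Zsemi> dag C g' = g \<Zsemi> dag C g \<boxplus> b \<Zsemi> dag C b"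
    "f' \<Zsemi> dag C g' = f \<Zsemi> dag C g \<boxplus> a \<Zsemi> dag C b" "g' \<Zsemi> dag C f' = g \<Zsemi> dag C f \<boxplus> b \<Zsemi> dag C a"
    and imp: "f' = g' \<longrightarrow> a = b"
    by (rule direct_sum_vectors[OF f g ab])
  have "u \<boxplus> (a \<Zsemi> dag C a \<boxplus> b \<Zsemi> dag C b) = f' \<Zsemi> dag C f' \<boxplus> g' \<Zsemi> dag C g'"
    "v \<boxplus> (a \<Zsemi> dag C b \<boxplus> b \<Zsemi> dag C a) = f' \<Zsemi> dag C g' \<boxplus> g' \<Zsemi> dag C f'"
    unfolding eq uv using D by (simp_all add: hadd_ac)
  with e have "f' \<Zsemi> dag C f' \<boxplus> g' \<Zsemi> dag C g' = f' \<Zsemi> dag C g' \<boxplus> g' \<Zsemi> dag C f'" by simp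
  then have "f' = g'" by (rule dag_difference_nondegenerate[OF fg])
  with imp show ?thesis by blast
qed

text \<open>The dagger reverses composition, which commutativity of the scalars turns into
  multiplicativity.\<close>

lemma involution_scalars: "involution (scalars C) (dag C)"
proof (rule involutionI)
  show "dag C \<in> ring_hom (scalars C) (scalars C)"
  proof (rule ring_hom_memI)
    fix a b assume "a \<in> carrier (scalars C)" "b \<in> carrier (scalars C)"
    then have ab: "a \<in> scalar_set" "b \<in> scalar_set" by simp_all
    note D = homsetD[OF ab(1)] homsetD[OF ab(2)]
    have "dag C a \<in> scalar_set" "dag C b \<in> scalar_set" using ab dag_in_homset by blast+
    then show "dag C (a \<otimes>\<^bsub>scalars C\<^esub> b) = dag C a \<otimes>\<^bsub>scalars C\<^esub> dag C b"
      using D scalars_commute by simp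
    show "dag C (a \<oplus>\<^bsub>scalars C\<^esub> b) = dag C a \<oplus>\<^bsub>scalars C\<^esub> dag C b" using D by simp
  qed (auto simp: dag_in_homset)
qed (simp add: homset_def)

lemma embeddable_semiring_scalars: "embeddable_semiring (scalars C) (dag C)"
proof (intro embeddable_semiring.intro cancel_comm_semiring.intro)
  show "semiring (scalars C)"
    by (rule semiring_scalars) (unfold_locales)
  show "cancel_comm_semiring_axioms (scalars C)"
    by unfold_locales (auto simp: scalars_commute intro: hadd_left_cancel)
  show "embeddable_semiring_axioms (scalars C) (dag C)"
    unfolding embeddable_semiring_axioms_def scalars_simps
    using involution_scalars zero_neq_one scalar_difference_integral scalar_difference_anisotropic
    by metis
qed

end

theorem theorem3p1:
  fixes C :: "('o, 'm) monoidal_dagger_category"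
  assumes "monoidal_dagger_category C"
    and "cmon_enriched_category C"
    and "has_finite_dagger_limits C"
    and "simple_tensor_unit C"
    and nontrivial: "hzero C (tunit C) (tunit C) \<noteq> idn C (tunit C)"
  shows "\<exists>(K :: ('m \<times> 'm \<times> 'm \<times> 'm) set ring) s h.
    field K \<and> involution K s \<and> characteristic_zero K \<and> orderable (fixed_field K s) \<and>
    semiring_embedding (scalars C) K h \<and>
    (\<forall>a\<in>carrier (scalars C). h (dag C a) = s (h a))"
proof -
  interpret M: monoidal_dagger_category C by (fact assms(1))
  interpret E: cmon_enriched_category C by (fact assms(2))
  interpret S: simple_scalar_category C
    by unfold_locales (use assms in auto)
  show ?thesis
    by (rule embeddable_semiring.embeds_in_orderable_field[OF S.embeddable_semiring_scalars])
qed

end
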